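(* Let $\mathcal{M}^\times=(S^\times,A^\times,T^\times,\beta^\times,Z_\phi^\times,Z_\psi^\times)$ be the double product MDP of a labeled Markov decision process $\mathcal{M}=(S,A,T,\beta,\Lambda,L)$ and two deterministic finite automata $\mathcal{A}_\phi=(Q_\phi,2^\Lambda,\delta_\phi,q_{\mathrm{init},\phi},Z_\phi)$ and $\mathcal{A}_\psi=(Q_\psi,2^\Lambda,\delta_\psi,q_{\mathrm{init},\psi},Z_\psi)$ whose final states are absorbing, and let $\tau\in[0,1]$. Consider the constrained reachability problem $$\max_{\pi^\times}\; P_{\pi^\times}(\sigma^\times\models\lozenge Z_\phi^\times)\quad\text{s.t.}\quad P_{\pi^\times}(\sigma^\times\models\lozenge Z_\psi^\times)\ge\tau,$$ where $\pi^\times$ ranges over all (possibly history-dependent and randomized) policies on $\mathcal{M}^\times$. If the problem is feasible (some policy satisfies the constraint), then there exists a stationary (possibly randomized) policy on $\mathcal{M}^\times$ that is optimal: it satisfies $P(\sigma^\times\models\lozenge Z_\psi^\times)\ge\tau$, and its value of $P(\sigma^\times\models\lozenge Z_\phi^\times)$ is at least that of every policy $\pi^\times$ on $\mathcal{M}^\times$ with $P_{\pi^\times}(\sigma^\times\models\lozenge Z_\psi^\times)\ge\tau$.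
   Context: A labeled Markov decision process (LMDP) is a tuple $\mathcal{M}=(S,A,T,\beta,\Lambda,L)$: $S$ is a finite set of states; $A$ a finite set of actions, with a nonempty set $A(s)\subseteq A$ of allowed actions at each $s$; $T:S\times A\times S\to[0,1]$ satisfies $\sum_{s'}T(s,a,s')=1$ if $a\in A(s)$ and $=0$ otherwise; $\beta$ is a probability distribution on $S$ (initial distribution); $\Lambda$ is a finite set of atomic propositions; $L:S\to 2^\Lambda$ is a labeling function. A policy maps each finite state-action history $h_t=(s_0,a_0,\ldots,s_t)$ (and the time $t$) to a probability distribution on the allowed actions at $s_t$. It is stationary if this distribution depends only on $s_t$. A policy $\pi$ and the initial distribution induce a probability measure $P_\pi$ on infinite trajectories: $s_0\sim\beta$, $a_t\sim\pi(h_t,t)$, $s_{t+1}\sim T(s_t,a_t,\cdot)$. A path $\sigma$ is the state sequence $s_0s_1s_2\cdots$; $\sigma\models\lozenge Y$, for a set $Y$ of states, means that $s_t\in Y$ for some $t\ge 0$. A deterministic finite automaton (DFA) $(Q,\Sigma,\delta,q_{\mathrm{init}},Z)$ has a finite state set $Q$, a finite alphabet $\Sigma$, a transition function $\delta:Q\times\Sigma\to Q$ (taken to be total), an initial state $q_{\mathrm{init}}\in Q$, and a set of final states $Z\subseteq Q$. Final states are absorbing: $\delta(q,\ell)=q$ for all $q\in Z$, $\ell\in\Sigma$. The double product MDP has: state set $S^\times=S\times Q_\phi\times Q_\psi$; action set $A^\times=A$ with allowed actions $A^\times(\langle s,q_\phi,q_\psi\rangle)=A(s)$; target sets $Z_\phi^\times=\{\langle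 s,q_\phi,q_\psi\rangle: q_\phi\in Z_\phi\}$ and $Z_\psi^\times=\{\langle s,q_\phi,q_\psi\rangle: q_\psi\in Z_\psi\}$; initial distribution $\beta^\times(\langle s,q_{\mathrm{init},\phi},q_{\mathrm{init},\psi}\rangle)=\beta(s)$ for $s\in S$ and $0$ at all other states; and transitions $T^\times(\langle s,q_\phi,q_\psi\rangle,a,\langle s',q_\phi',q_\psi'\rangle)=T(s,a,s')$ if $q_\phi'=\delta_\phi(q_\phi,L(s))$ and $q_\psi'=\delta_\psi(q_\psi,L(s))$, and $0$ otherwise. *)

theory Defs
  imports "HOL-Probability.Probability"
begin

record ('s, 'a) mdp =
  states :: "'s set"
  actions :: "'a set"
  allowed :: "'s \<Rightarrow> 'a set"
  trans_prob :: "'s \<Rightarrow> 'a \<Rightarrow> 's \<Rightarrow> real"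
  init_dist :: "'s pmf"

record ('s, 'a, 'l) lmdp = "('s, 'a) mdp" +
  props :: "'l set"
  label :: "'s \<Rightarrow> 'l set"

record ('s, 'a) target_mdp = "('s, 'a) mdp" +
  target_phi :: "'s set"
  target_psi :: "'s set"

record ('q, 'x) dfa =
  dstates :: "'q set"
  alphabet :: "'x set"
  delta :: "'q \<Rightarrow> 'x \<Rightarrow> 'q"
  dinit :: 'q
  final :: "'q set"

locale mdp =
  fixes M :: "('s, 'a, 'm) mdp_scheme"
  assumes finite_states: "finite (states M)"
    and finite_actions: "finite (actions M)"
    and allowed_subset: "s \<in> states M \<Longrightarrow> allowed M s \<subseteq> actions M"
    and allowed_nonempty: "s \<in> states M \<Longrightarrow> allowed M s \<noteq> {}"
    and trans_range: "\<lbrakk>s \<in> states M; a \<in> actions M; s' \<in> states M\<rbrakk> \<Longrightarrow> trans_prob M s a s' \<in> {0..1}"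
    and trans_sum: "\<lbrakk>s \<in> states M; a \<in> actions M\<rbrakk> \<Longrightarrow>
      (\<Sum>s'\<in>states M. trans_prob M s a s') = (if a \<in> allowed M s then 1 else 0)"
    and init_support: "set_pmf (init_dist M) \<subseteq> states M"

locale lmdp = mdp M for M :: "('s, 'a, 'l, 'm) lmdp_scheme" +
  assumes finite_props: "finite (props M)"
    and label_subset: "s \<in> states M \<Longrightarrow> label M s \<subseteq> props M"

locale dfa =
  fixes D :: "('q, 'x, 'm) dfa_scheme"
  assumes finite_dstates: "finite (dstates D)"
    and finite_alphabet: "finite (alphabet D)"
    and delta_closed: "\<lbrakk>q \<in> dstates D; x \<in> alphabet D\<rbrakk> \<Longrightarrow> delta D q x \<in> dstates D"
    and dinit_in: "dinit D \<in> dstates D"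
    and final_subset: "final D \<subseteq> dstates D"

locale absorbing_dfa = dfa +
  assumes final_absorbing: "\<lbrakk>q \<in> final D; x \<in> alphabet D\<rbrakk> \<Longrightarrow> delta D q x = q"

text \<open>
  A history \<open>(s\<^sub>0, a\<^sub>0, \<dots>, s\<^sub>t)\<close> is given by the list
  \<open>[(s\<^sub>0, a\<^sub>0), \<dots>, (s\<^sub>t\<^sub>-\<^sub>1, a\<^sub>t\<^sub>-\<^sub>1)]\<close> together with the current state \<open>s\<^sub>t\<close>.
  The time \<open>t\<close> is the length of the list, so it is not a separate argument of a policy.
  Only histories in which every action is allowed are considered; all others are unreachable.
\<close>

type_synonym ('s, 'a) policy = "('s \<times> 'a) list \<Rightarrow> 's \<Rightarrow> 'a pmf"

definition sa_pairs :: "('s, 'a, 'm) mdp_scheme \<Rightarrow> ('s \<times> 'a) set" where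
  "sa_pairs M = (SIGMA s:states M. allowed M s)"

definition is_policy :: "('s, 'a, 'm) mdp_scheme \<Rightarrow> ('s, 'a) policy \<Rightarrow> bool" where
  "is_policy M \<pi> \<longleftrightarrow>
    (\<forall>h\<in>lists (sa_pairs M). \<forall>s\<in>states M. set_pmf (\<pi> h s) \<subseteq> allowed M s)"

definition stationary :: "('s, 'a, 'm) mdp_scheme \<Rightarrow> ('s, 'a) policy \<Rightarrow> bool" where
  "stationary M \<pi> \<longleftrightarrow>
    (\<exists>d. \<forall>h\<in>lists (sa_pairs M). \<forall>s\<in>states M. \<pi> h s = d s)"

text \<open>
  A trajectory \<open>\<omega>\<close> is a sequence of pairs \<open>\<omega> t = (s\<^sub>t, a\<^sub>t)\<close>.
  The kernel below is the conditional distribution of \<open>(s\<^sub>t, a\<^sub>t)\<close> given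
  \<open>\<omega> 0, \<dots>, \<omega> (t - 1)\<close>; the trajectory measure is the measure with these
  kernels provided by the Ionescu-Tulcea theorem.
\<close>

definition state_prob ::
  "('s, 'a, 'm) mdp_scheme \<Rightarrow> nat \<Rightarrow> (nat \<Rightarrow> 's \<times> 'a) \<Rightarrow> 's \<Rightarrow> real" where
  "state_prob M t \<omega> s =
    (case t of 0 \<Rightarrow> pmf (init_dist M) s
     | Suc u \<Rightarrow> trans_prob M (fst (\<omega> u)) (snd (\<omega> u)) s)"

definition step_kernel ::
  "('s, 'a, 'm) mdp_scheme \<Rightarrow> ('s, 'a) policy \<Rightarrow> nat \<Rightarrow> (nat \<Rightarrow> 's \<times> 'a) \<Rightarrow> ('s \<times> 'a) measure" where
  "step_kernel M \<pi> t \<omega> =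
    point_measure (sa_pairs M)
      (\<lambda>(s, a). ennreal (state_prob M t \<omega> s * pmf (\<pi> (map \<omega> [0..<t]) s) a))"

definition traj_measure ::
  "('s, 'a, 'm) mdp_scheme \<Rightarrow> ('s, 'a) policy \<Rightarrow> (nat \<Rightarrow> 's \<times> 'a) measure" where
  "traj_measure M \<pi> =
    projective_family.lim UNIV
      (Ionescu_Tulcea.CI (step_kernel M \<pi>) (\<lambda>_. count_space (sa_pairs M)))
      (\<lambda>_. count_space (sa_pairs M))"

definition path :: "(nat \<Rightarrow> 's \<times> 'a) \<Rightarrow> nat \<Rightarrow> 's" where
  "path \<omega> t = fst (\<omega> t)"

definition reaches :: "(nat \<Rightarrow> 's) \<Rightarrow> 's set \<Rightarrow> bool" where
  "reaches \<sigma> Y \<longleftrightarrow> (\<exists>t. \<sigma> t \<in> Y)"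

definition reach_prob ::
  "('s, 'a, 'm) mdp_scheme \<Rightarrow> ('s, 'a) policy \<Rightarrow> 's set \<Rightarrow> real" where
  "reach_prob M \<pi> Y = \<P>(\<omega> in traj_measure M \<pi>. reaches (path \<omega>) Y)"

context mdp
begin

lemma finite_sa_pairs: "finite (sa_pairs M)"
  unfolding sa_pairs_def
  using finite_states finite_actions allowed_subset by (auto intro: finite_subset)

lemma state_prob_nonneg:
  assumes "\<omega> \<in> {0..<t} \<rightarrow> sa_pairs M" "s \<in> states M"
  shows "0 \<le> state_prob M t \<omega> s"
proof (cases t)
  case (Suc u)
  then have "\<omega> u \<in> sa_pairs M" using assms by auto
  then have "fst (\<omega> u) \<in> states M" "snd (\<omega> u) \<in> actions M"
    using allowed_subset[of "fst (\<omega> u)"] by (auto simp: sa_pairs_def)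
  then show ?thesis using trans_range assms(2) Suc by (auto simp: state_prob_def)
qed (simp add: state_prob_def)

lemma state_prob_sum:
  assumes "\<omega> \<in> {0..<t} \<rightarrow> sa_pairs M"
  shows "(\<Sum>s\<in>states M. state_prob M t \<omega> s) = 1"
proof (cases t)
  case 0
  then show ?thesis
    using sum_pmf_eq_1[OF finite_states init_support] by (simp add: state_prob_def)
next
  case (Suc u)
  then have "\<omega> u \<in> sa_pairs M" using assms by auto
  then have "fst (\<omega> u) \<in> states M" "snd (\<omega> u) \<in> allowed M (fst (\<omega> u))"
    "snd (\<omega> u) \<in> actions M"
    using allowed_subset[of "fst (\<omega> u)"] by (auto simp: sa_pairs_def)
  then show ?thesis using trans_sum Suc by (simp add: state_prob_def)
qed

lemma Ionescu_Tulcea_step_kernel: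
  assumes "is_policy M \<pi>"
  shows "Ionescu_Tulcea (step_kernel M \<pi>) (\<lambda>_. count_space (sa_pairs M))"
proof -
  have fin: "finite (allowed M s)" if "s \<in> states M" for s
    using that allowed_subset finite_actions finite_subset by blast
  have prob: "prob_space (step_kernel M \<pi> t \<omega>)"
    if "\<omega> \<in> space (PiM {0..<t} (\<lambda>_. count_space (sa_pairs M)))" for t \<omega>
  proof
    have \<omega>: "\<omega> \<in> {0..<t} \<rightarrow> sa_pairs M" using that by (auto simp: space_PiM)
    let ?h = "map \<omega> [0..<t]"
    have h: "?h \<in> lists (sa_pairs M)" using funcset_mem[OF \<omega>] by (force simp: in_lists_conv_set)
    have "emeasure (step_kernel M \<pi> t \<omega>) (sa_pairs M)
      = (\<Sum>(s, a)\<in>sa_pairs M. ennreal (state_prob M t \<omega> s * pmf (\<pi> ?h s) a))"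
      by (simp add: step_kernel_def emeasure_point_measure_finite finite_sa_pairs)
    also have "\<dots> = ennreal (\<Sum>(s, a)\<in>sa_pairs M. state_prob M t \<omega> s * pmf (\<pi> ?h s) a)"
      using state_prob_nonneg[OF \<omega>]
      by (subst sum_ennreal[symmetric])
         (auto simp: sa_pairs_def split_beta intro!: mult_nonneg_nonneg)
    also have "(\<Sum>(s, a)\<in>sa_pairs M. state_prob M t \<omega> s * pmf (\<pi> ?h s) a)
      = (\<Sum>s\<in>states M. \<Sum>a\<in>allowed M s. state_prob M t \<omega> s * pmf (\<pi> ?h s) a)"
      unfolding sa_pairs_def using finite_states fin by (subst sum.Sigma) auto
    also have "\<dots> = (\<Sum>s\<in>states M. state_prob M t \<omega> s)"
      using assms h fin
      by (intro sum.cong refl) (simp add: sum_distrib_left[symmetric] sum_pmf_eq_1 is_policy_def)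
    finally show "emeasure (step_kernel M \<pi> t \<omega>) (space (step_kernel M \<pi> t \<omega>)) = 1"
      using state_prob_sum[OF \<omega>] by (simp add: step_kernel_def space_point_measure)
  qed
  have "step_kernel M \<pi> t \<in> measurable (PiM {0..<t} (\<lambda>_. count_space (sa_pairs M)))
      (subprob_algebra (count_space (sa_pairs M)))" for t
  proof -
    have "step_kernel M \<pi> t \<in> space (PiM {0..<t} (\<lambda>_. count_space (sa_pairs M))) \<rightarrow>
        space (subprob_algebra (count_space (sa_pairs M)))"
      using prob by (auto simp: space_subprob_algebra prob_space_imp_subprob_space
          step_kernel_def sets_point_measure)
    then show ?thesis
      using finite_sa_pairs
      by (simp add: count_space_PiM_finite countable_finite)
  qed
  with prob show ?thesis by (intro Ionescu_Tulcea.intro)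
qed

lemma sets_traj_measure:
  assumes "is_policy M \<pi>"
  shows "sets (traj_measure M \<pi>) = sets (PiM UNIV (\<lambda>_. count_space (sa_pairs M)))"
proof -
  interpret Ionescu_Tulcea "step_kernel M \<pi>" "\<lambda>_. count_space (sa_pairs M)"
    using assms by (rule Ionescu_Tulcea_step_kernel)
  show ?thesis by (simp add: traj_measure_def)
qed

lemma space_traj_measure:
  assumes "is_policy M \<pi>"
  shows "space (traj_measure M \<pi>) = UNIV \<rightarrow> sa_pairs M"
  unfolding sets_eq_imp_space_eq[OF sets_traj_measure[OF assms]]
  by (auto simp: space_PiM PiE_iff)

lemma prob_space_traj_measure:
  assumes "is_policy M \<pi>"
  shows "prob_space (traj_measure M \<pi>)"
proof -
  interpret Ionescu_Tulcea "step_kernel M \<pi>" "\<lambda>_. count_space (sa_pairs M)"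
    using assms by (rule Ionescu_Tulcea_step_kernel)
  let ?N = "PiM {} (\<lambda>_. count_space (sa_pairs M))"
  have "prob_space (CI {})" by (rule PF.prob_space_P) auto
  then have "prob_space (distr PF.lim ?N (\<lambda>x. restrict x {}))" by (simp add: distr_lim)
  moreover have "(\<lambda>x. restrict x {}) \<in> measurable PF.lim ?N"
    unfolding measurable_cong_sets[OF PF.sets_lim refl]
    by (rule measurable_restrict_subset) simp
  ultimately show ?thesis
    unfolding traj_measure_def by (rule prob_space_distrD[rotated])
qed

lemma sets_reaches:
  assumes "is_policy M \<pi>"
  shows "{\<omega> \<in> space (traj_measure M \<pi>). reaches (path \<omega>) Y} \<in> sets (traj_measure M \<pi>)"
proof -
  let ?N = "PiM UNIV (\<lambda>_::nat. count_space (sa_pairs M))"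
  have "{\<omega> \<in> space ?N. \<omega> t \<in> Y \<times> UNIV} \<in> sets ?N" for t :: nat
  proof -
    have "(\<lambda>\<omega>. \<omega> t) \<in> measurable ?N (count_space (sa_pairs M))"
      by (rule measurable_component_singleton) simp
    then have "(\<lambda>\<omega>. \<omega> t) -` (sa_pairs M \<inter> Y \<times> UNIV) \<inter> space ?N \<in> sets ?N"
      by (rule measurable_sets) simp
    also have "(\<lambda>\<omega>. \<omega> t) -` (sa_pairs M \<inter> Y \<times> UNIV) \<inter> space ?N
        = {\<omega> \<in> space ?N. \<omega> t \<in> Y \<times> UNIV}"
      by (auto simp: space_PiM)
    finally show ?thesis .
  qed
  then have "(\<Union>t. {\<omega> \<in> space ?N. \<omega> t \<in> Y \<times> UNIV}) \<in> sets ?N"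
    by (intro sets.countable_UN image_subsetI)
  also have "(\<Union>t. {\<omega> \<in> space ?N. \<omega> t \<in> Y \<times> UNIV})
      = {\<omega> \<in> space (traj_measure M \<pi>). reaches (path \<omega>) Y}"
    unfolding sets_eq_imp_space_eq[OF sets_traj_measure[OF assms]]
    by (auto simp: reaches_def path_def mem_Times_iff)
  finally show ?thesis unfolding sets_traj_measure[OF assms] .
qed

lemma emeasure_traj_measure_cylinder:
  assumes \<pi>: "is_policy M \<pi>" and x: "\<And>i. i < n \<Longrightarrow> x i \<in> sa_pairs M"
  shows "emeasure (traj_measure M \<pi>) {\<omega> \<in> space (traj_measure M \<pi>). \<forall>i<n. \<omega> i = x i} =
    (\<Prod>i<n. ennreal (state_prob M i x (fst (x i)) * pmf (\<pi> (map x [0..<i]) (fst (x i))) (snd (x i))))"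
proof -
  interpret Ionescu_Tulcea "step_kernel M \<pi>" "\<lambda>_. count_space (sa_pairs M)"
    using \<pi> by (rule Ionescu_Tulcea_step_kernel)
  let ?N = "\<lambda>m::nat. PiM {0..<m} (\<lambda>_. count_space (sa_pairs M))"
  let ?p = "\<lambda>i. ennreal (state_prob M i x (fst (x i)) * pmf (\<pi> (map x [0..<i]) (fst (x i))) (snd (x i)))"
  have N: "?N m = count_space ({0..<m} \<rightarrow>\<^sub>E sa_pairs M)" for m
    by (rule count_space_PiM_finite) (auto intro: countable_finite finite_sa_pairs)
  have x_in: "restrict x {0..<m} \<in> space (?N m)" if "m \<le> n" for m
    using that x by (auto simp: space_PiM)
  have "emeasure (C 0 m (\<lambda>_. undefined)) {restrict x {0..<m}} = (\<Prod>i<m. ?p i)" if "m \<le> n" for m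
    using that
  proof (induction m)
    case 0
    have *: "{\<lambda>_. undefined} \<in> sets (?N 0)" unfolding N by simp
    have r: "restrict x {0..<0} = (\<lambda>_. undefined)" by (simp add: fun_eq_iff)
    show ?case unfolding C.simps r emeasure_return[OF *] by simp
  next
    case (Suc m)
    let ?x = "restrict x {0..<m}" and ?y = "restrict x {0..<Suc m}"
    let ?C = "C 0 m (\<lambda>_. undefined)"
    have sp: "space ?C = space (?N m)" by (simp add: space_C space_PiM)
    have st: "sets ?C = sets (?N m)" using sets_C[of "\<lambda>_. undefined" 0 m] by (simp add: space_PiM)
    have y: "{?y} \<in> sets (?N (Suc m))" using x_in[OF Suc.prems] unfolding N by simp
    have eP: "eP m \<omega> {?y} = ?p m * indicator {?x} \<omega>" if \<omega>: "\<omega> \<in> space (?N m)" for \<omega>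
    proof (cases "\<omega> = ?x")
      case True
      have "(\<lambda>a. fun_upd ?x m a) -` {?y} \<inter> sa_pairs M = {x m}"
        using x[of m] Suc.prems by (auto simp: fun_eq_iff restrict_def split: if_splits)
      then have "eP m \<omega> {?y} = step_kernel M \<pi> m \<omega> {x m}"
        using emeasure_eP[OF \<omega> y] True by simp
      moreover have "map ?x [0..<m] = map x [0..<m]" by simp
      moreover have "state_prob M m ?x = state_prob M m x"
        by (auto simp: state_prob_def fun_eq_iff split: nat.split)
      ultimately show ?thesis
        using x[of m] Suc.prems True
        by (simp add: step_kernel_def emeasure_point_measure_finite finite_sa_pairs split_beta
            del: map_eq_conv)
    next
      case False
      have "(\<lambda>a. fun_upd \<omega> m a) -` {?y} = {}"
      proof (rule ccontr)
        assume "(\<lambda>a. fun_upd \<omega> m a) -` {?y} \<noteq> {}"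
        then obtain a where a: "fun_upd \<omega> m a = ?y" by auto
        have "\<omega> i = ?x i" for i
          using fun_cong[OF a, of i] \<omega>
          by (cases "i < m") (auto simp: space_PiM PiE_iff extensional_def split: if_splits)
        then show False using False by auto
      qed
      then show ?thesis using emeasure_eP[OF \<omega> y] False by simp
    qed
    have "emeasure (C 0 (Suc m) (\<lambda>_. undefined)) {?y} = (\<integral>\<^sup>+\<omega>. eP m \<omega> {?y} \<partial>?C)"
    proof -
      have "space ?C \<noteq> {}" using x_in[OF Suc_leD[OF Suc.prems]] unfolding sp by blast
      moreover have "eP m \<in> measurable ?C (subprob_algebra (?N (Suc m)))"
        unfolding measurable_cong_sets[OF st refl] by (rule measurable_eP)
      ultimately show ?thesis
        using emeasure_bind[of ?C "eP m" "?N (Suc m)", OF _ _ y] by simp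
    qed
    also have "\<dots> = (\<integral>\<^sup>+\<omega>. ?p m * indicator {?x} \<omega> \<partial>?C)"
      by (intro nn_integral_cong eP) (simp only: sp)
    also have "\<dots> = ?p m * emeasure ?C {?x}"
    proof (rule nn_integral_cmult_indicator)
      show "{?x} \<in> sets ?C" using x_in[of m] Suc.prems unfolding st N by simp
    qed
    also have "emeasure ?C {?x} = (\<Prod>i<m. ?p i)" using Suc.IH[OF Suc_leD[OF Suc.prems]] .
    finally show ?case unfolding prod.lessThan_Suc by (simp only: mult.commute)
  qed
  note C = this[OF order_refl]
  have X: "{restrict x {0..<n}} \<in> sets (?N n)" using x_in[of n] unfolding N by simp
  have "{\<omega> \<in> space (traj_measure M \<pi>). \<forall>i<n. \<omega> i = x i}
      = PF.emb UNIV {0..<n} {restrict x {0..<n}}"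
    unfolding space_traj_measure[OF \<pi>] prod_emb_def
    by (auto simp: space_PiM PiE_iff fun_eq_iff restrict_def split: if_splits)
  then have "emeasure (traj_measure M \<pi>) {\<omega> \<in> space (traj_measure M \<pi>). \<forall>i<n. \<omega> i = x i}
      = emeasure (CI {0..<n}) {restrict x {0..<n}}"
    using lim[OF _ X] unfolding traj_measure_def by simp
  also have "\<dots> = emeasure (C 0 n (\<lambda>_. undefined)) (PF.emb {0..<n} {0..<n} {restrict x {0..<n}})"
    by (rule emeasure_CI[OF _ X]) simp
  also have "PF.emb {0..<n} {0..<n} {restrict x {0..<n}} = {restrict x {0..<n}}"
    using x_in[of n] by (auto simp: prod_emb_def space_PiM)
  finally show ?thesis unfolding C .
qed

end

definition double_product ::
  "('s, 'a, 'l) lmdp \<Rightarrow> ('q, 'l set) dfa \<Rightarrow> ('r, 'l set) dfa \<Rightarrow> ('s \<times> 'q \<times> 'r, 'a) target_mdp" where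
  "double_product M D E =
    \<lparr> states = states M \<times> dstates D \<times> dstates E,
      actions = actions M,
      allowed = (\<lambda>(s, q, r). allowed M s),
      trans_prob = (\<lambda>(s, q, r) a (s', q', r').
        if q' = delta D q (label M s) \<and> r' = delta E r (label M s)
        then trans_prob M s a s' else 0),
      init_dist = map_pmf (\<lambda>s. (s, dinit D, dinit E)) (init_dist M),
      target_phi = {(s, q, r). s \<in> states M \<and> q \<in> final D \<and> r \<in> dstates E},
      target_psi = {(s, q, r). s \<in> states M \<and> q \<in> dstates D \<and> r \<in> final E} \<rparr>"

lemma pmf_init_dist_double_product:
  "pmf (init_dist (double_product M D E)) (s, q, r) =
    (if q = dinit D \<and> r = dinit E then pmf (init_dist M) s else 0)"
proof (cases "q = dinit D \<and> r = dinit E")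
  case True
  have "inj (\<lambda>s. (s, dinit D, dinit E))" by (auto intro: injI)
  from pmf_map_inj'[OF this, of "init_dist M" s] True show ?thesis
    by (simp add: double_product_def)
next
  case False
  then show ?thesis by (auto simp: double_product_def pmf_eq_0_set_pmf)
qed

lemma mdp_double_product:
  assumes "lmdp M" "dfa D" "dfa E"
    and "alphabet D = Pow (props M)" "alphabet E = Pow (props M)"
  shows "mdp (double_product M D E)"
proof -
  interpret lmdp M by fact
  interpret D: dfa D by fact
  interpret E: dfa E by fact
  let ?P = "double_product M D E"
  show ?thesis
  proof
    fix x a assume x: "x \<in> states ?P" and a: "a \<in> actions ?P"
    obtain s q r where [simp]: "x = (s, q, r)" by (cases x)
    have s: "s \<in> states M" "a \<in> actions M" using x a by (auto simp: double_product_def)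
    let ?q = "delta D q (label M s)" and ?r = "delta E r (label M s)"
    have q: "?q \<in> dstates D" "?r \<in> dstates E"
      using x assms(4,5) label_subset D.delta_closed E.delta_closed
      by (auto simp: double_product_def)
    have "(\<Sum>y\<in>states ?P. trans_prob ?P x a y)
      = (\<Sum>y\<in>(\<lambda>s'. (s', ?q, ?r)) ` states M. trans_prob ?P x a y)"
      using q finite_states D.finite_dstates E.finite_dstates
      by (intro sum.mono_neutral_right) (auto simp: double_product_def)
    also have "\<dots> = (\<Sum>s'\<in>states M. trans_prob M s a s')"
      by (subst sum.reindex) (auto simp: double_product_def inj_on_def)
    finally show "(\<Sum>y\<in>states ?P. trans_prob ?P x a y) = (if a \<in> allowed ?P x then 1 else 0)"
      using trans_sum s by (simp add: double_product_def)
  next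
    fix x a y assume "x \<in> states ?P" "a \<in> actions ?P" "y \<in> states ?P"
    then show "trans_prob ?P x a y \<in> {0..1}"
      using trans_range by (cases x, cases y) (auto simp: double_product_def)
  next
    fix x assume "x \<in> states ?P"
    then show "allowed ?P x \<subseteq> actions ?P" "allowed ?P x \<noteq> {}"
      using allowed_subset allowed_nonempty by (auto simp: double_product_def)
  next
    show "finite (states ?P)" "finite (actions ?P)" "set_pmf (init_dist ?P) \<subseteq> states ?P"
      using finite_states finite_actions init_support D.finite_dstates E.finite_dstates
        D.dinit_in E.dinit_in
      by (auto simp: double_product_def)
  qed
qed

end

theory Submission
  imports Defs
begin

text \<open>
  Both targets are closed under transitions, so the probability of reaching \<open>Y\<close> is the limit of
  the probability of being in \<open>Y\<close> at time \<open>t\<close>. For any policy, the expected number \<open>x (s, a)\<close> of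
  uses of \<open>(s, a)\<close> before time \<open>n\<close> is finite and satisfies the flow inequality
  \<open>x \<le> \<beta> + x T\<close> at every state, and \<open>\<beta> Y\<close> plus the flow of \<open>x\<close> into \<open>Y\<close> is the probability of
  being in \<open>Y\<close> at time \<open>n\<close>. Although the vectors \<open>x\<close> may be unbounded as \<open>n\<close> grows and the policy
  approaches the optimum, finitely generated cones are closed, so some \<open>x\<close> satisfying the flow
  inequality attains the limit of the flows into the targets. Conversely, let \<open>d\<close> be the stationary
  policy with \<open>d (a | s) = x (s, a) / x s\<close> and transition matrix \<open>P\<close>. Iterating \<open>x \<le> \<beta> + x P\<close>
  gives \<open>x \<le> \<beta> + \<beta> P + \<dots> + \<beta> P^(n-1) + x P^n\<close>, and the flow of \<open>x P^n\<close> into \<open>Y\<close> tends to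
  \<open>0\<close> because the total mass is bounded; hence \<open>d\<close> reaches \<open>Y\<close> with at least the probability
  prescribed by \<open>x\<close>.
\<close>

section \<open>Closedness of finitely generated cones\<close>

text \<open>Bolzano-Weierstrass, one coordinate at a time: each new index passes to a further
  subsequence, along which the earlier limits persist.\<close>

lemma convergent_subsequence_on_finite:
  fixes c :: "nat \<Rightarrow> 'j \<Rightarrow> real"
  assumes "finite J" and "\<And>n j. j \<in> J \<Longrightarrow> \<bar>c n j\<bar> \<le> B"
  shows "\<exists>l r. strict_mono r \<and> (\<forall>j\<in>J. (\<lambda>n. c (r n) j) \<longlonglongrightarrow> l j)"
  using assms
proof (induction J)
  case empty
  show ?case by (auto intro: strict_mono_id)
next
  case (insert i J)
  then obtain l r where r: "strict_mono r" and l: "\<forall>j\<in>J. (\<lambda>n. c (r n) j) \<longlonglongrightarrow> l j"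
    by auto
  have "bounded (range (\<lambda>n. c (r n) i))"
    using insert.prems[of i] by (auto simp: bounded_iff)
  then obtain l' r' where r': "strict_mono r'" and l': "((\<lambda>n. c (r n) i) \<circ> r') \<longlonglongrightarrow> l'"
    using bounded_imp_convergent_subsequence by blast
  have "(\<lambda>n. c ((r \<circ> r') n) j) \<longlonglongrightarrow> (l(i := l')) j" if "j \<in> insert i J" for j
  proof (cases "j = i")
    case True
    then show ?thesis using l' by (simp add: o_def)
  next
    case False
    then have "(\<lambda>n. c (r n) j) \<longlonglongrightarrow> l j" using that l by auto
    from LIMSEQ_subseq_LIMSEQ[OF this r'] False show ?thesis by (simp add: o_def)
  qed
  then show ?case using strict_mono_o[OF r r'] by blast
qed

text \<open>Induction on the number of generators. If the coefficient sums \<open>S\<close> do not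
  diverge, they are bounded along a subsequence and compactness yields limit coefficients. If they
  diverge, the normalised coefficients converge to a nontrivial nonnegative relation among the
  generators, which is used to eliminate one generator as in Caratheodory's theorem.\<close>

lemma closed_finite_cone:
  fixes c :: "nat \<Rightarrow> 'j \<Rightarrow> real" and v :: "'j \<Rightarrow> 'i \<Rightarrow> real"
  assumes "finite J" and "\<And>n j. j \<in> J \<Longrightarrow> 0 \<le> c n j"
    and "\<And>i. i \<in> I \<Longrightarrow> (\<lambda>n. \<Sum>j\<in>J. c n j * v j i) \<longlonglongrightarrow> b i"
  shows "\<exists>c'. (\<forall>j\<in>J. 0 \<le> c' j) \<and> (\<forall>i\<in>I. (\<Sum>j\<in>J. c' j * v j i) = b i)"
  using assms
proof (induction "card J" arbitrary: J c rule: less_induct)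
  case less
  note fin = less.prems(1) and nonneg = less.prems(2) and lim = less.prems(3)
  define S where "S n = (\<Sum>j\<in>J. c n j)" for n
  have le_S: "c n j \<le> S n" if "j \<in> J" for n j
    unfolding S_def using fin nonneg that by (intro member_le_sum) auto
  show ?case
  proof (cases "filterlim S at_top sequentially")
    case False
    then obtain B where "\<not> (\<forall>\<^sub>F n in sequentially. B \<le> S n)"
      by (auto simp: filterlim_at_top)
    then have "\<exists>\<^sub>F n in sequentially. S n \<le> B"
      by (auto simp: not_eventually elim: frequently_elim1)
    then have "infinite {n. S n \<le> B}"
      by (simp add: cofinite_eq_sequentially[symmetric] frequently_cofinite)
    then obtain r :: "nat \<Rightarrow> nat" where r: "strict_mono r" "\<And>n. S (r n) \<le> B"
      using infinite_enumerate by (metis mem_Collect_eq)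
    have "\<bar>c (r n) j\<bar> \<le> B" if "j \<in> J" for n j
      using le_S[OF that, of "r n"] r(2)[of n] nonneg[OF that] by simp
    from convergent_subsequence_on_finite[of J "\<lambda>n. c (r n)" B, OF fin this] obtain l r' where
      r': "strict_mono r'" "\<And>j. j \<in> J \<Longrightarrow> (\<lambda>n. c (r (r' n)) j) \<longlonglongrightarrow> l j" by blast
    have "0 \<le> l j" if "j \<in> J" for j
      using LIMSEQ_le_const[OF r'(2)[OF that]] nonneg[OF that] by auto
    moreover have "(\<Sum>j\<in>J. l j * v j i) = b i" if "i \<in> I" for i
    proof (rule LIMSEQ_unique)
      show "(\<lambda>n. \<Sum>j\<in>J. c (r (r' n)) j * v j i) \<longlonglongrightarrow> (\<Sum>j\<in>J. l j * v j i)"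
        using r'(2) by (intro tendsto_intros)
      show "(\<lambda>n. \<Sum>j\<in>J. c (r (r' n)) j * v j i) \<longlonglongrightarrow> b i"
        using LIMSEQ_subseq_LIMSEQ[OF lim[OF that] strict_mono_o[OF r(1) r'(1)]]
        by (simp add: o_def)
    qed
    ultimately show ?thesis by blast
  next
    case True
    \<comment> \<open>The maximum with 1 guards against a vanishing \<open>S n\<close>; since
      \<open>S\<close> diverges, it equals \<open>S n\<close> for all large
      \<open>n\<close>.\<close>
    define u where "u n j = c n j / max 1 (S n)" for n j
    have "\<bar>u n j\<bar> \<le> 1" if "j \<in> J" for n j
      using le_S[OF that, of n] nonneg[OF that, of n] by (auto simp: u_def divide_simps max_def)
    from convergent_subsequence_on_finite[of J u 1, OF fin this] obtain l r where
      r: "strict_mono r" and ul: "\<And>j. j \<in> J \<Longrightarrow> (\<lambda>n. u (r n) j) \<longlonglongrightarrow> l j" by blast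
    have lnn: "0 \<le> l j" if "j \<in> J" for j
      using LIMSEQ_le_const[OF ul[OF that]] nonneg[OF that] by (auto simp: u_def)
    have Sr: "filterlim (\<lambda>n. S (r n)) at_top sequentially"
      using True filterlim_subseq[OF r] by (rule filterlim_compose)
    then have ev: "\<forall>\<^sub>F n in sequentially. 1 \<le> S (r n)"
      by (auto simp: filterlim_at_top)
    have "(\<lambda>n. \<Sum>j\<in>J. u (r n) j) \<longlonglongrightarrow> (\<Sum>j\<in>J. l j)"
      using ul by (intro tendsto_intros)
    moreover have "(\<lambda>n. \<Sum>j\<in>J. u (r n) j) \<longlonglongrightarrow> 1"
      using ev by (intro tendsto_eventually)
        (auto simp: u_def S_def sum_divide_distrib[symmetric] max_def elim!: eventually_mono)
    ultimately have l1: "(\<Sum>j\<in>J. l j) = 1" by (rule LIMSEQ_unique)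
    \<comment> \<open>The combinations converge while \<open>S\<close> diverges, so the normalised
      combinations vanish in the limit: \<open>l\<close> is a relation among the generators,
      nontrivial by \<open>l1\<close>.\<close>
    have l0: "(\<Sum>j\<in>J. l j * v j i) = 0" if "i \<in> I" for i
    proof (rule LIMSEQ_unique)
      show "(\<lambda>n. \<Sum>j\<in>J. u (r n) j * v j i) \<longlonglongrightarrow> (\<Sum>j\<in>J. l j * v j i)"
        using ul by (intro tendsto_intros)
      have "(\<lambda>n. (\<Sum>j\<in>J. c (r n) j * v j i) / S (r n)) \<longlonglongrightarrow> 0"
        using LIMSEQ_subseq_LIMSEQ[OF lim[OF that] r] Sr
        by (intro real_tendsto_divide_at_top) (auto simp: o_def)
      then show "(\<lambda>n. \<Sum>j\<in>J. u (r n) j * v j i) \<longlonglongrightarrow> 0"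
        by (rule Lim_transform_eventually)
          (use ev in \<open>auto simp: u_def sum_divide_distrib max_def elim!: eventually_mono\<close>)
    qed
    define P where "P = {j\<in>J. 0 < l j}"
    have "P \<noteq> {}"
    proof
      assume "P = {}"
      then have "\<forall>j\<in>J. l j = 0" using lnn by (force simp: P_def)
      then show False using l1 by simp
    qed
    have finP: "finite P" using fin by (simp add: P_def)
    \<comment> \<open>Ratio test: the smallest \<open>c n j / l j\<close> is the largest multiple of
      \<open>l\<close> that can be subtracted while all coefficients stay nonnegative. The
      minimising index varies with \<open>n\<close>, but by pigeonhole one index recurs infinitely
      often.\<close>
    have "\<exists>j\<in>P. \<forall>i\<in>P. c n j / l j \<le> c n i / l i" for n
      using finP \<open>P \<noteq> {}\<close> by (intro bexI[of _ "arg_min_on (\<lambda>j. c n j / l j) P"] ballI)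
        (auto intro: arg_min_least arg_min_if_finite)
    then obtain k where k: "\<And>n. k n \<in> P" "\<And>n i. i \<in> P \<Longrightarrow> c n (k n) / l (k n) \<le> c n i / l i"
      by metis
    have "\<exists>j\<in>P. infinite {n. k n = j}"
    proof (rule ccontr)
      assume "\<not> ?thesis"
      then have "finite (\<Union>j\<in>P. {n. k n = j})" using finP by auto
      moreover have "(\<Union>j\<in>P. {n. k n = j}) = UNIV" using k(1) by auto
      ultimately show False by simp
    qed
    then obtain j where j: "j \<in> P" "infinite {n. k n = j}" by blast
    from infinite_enumerate[OF j(2)] obtain q :: "nat \<Rightarrow> nat" where
      q: "strict_mono q" "\<And>n. k (q n) = j" by auto
    have jJ: "j \<in> J" "0 < l j" using j(1) by (auto simp: P_def)
    text \<open>Moving along the relation \<open>l\<close> until the coefficient of \<open>j\<close> vanishes.\<close>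
    define c' where "c' n i = c (q n) i - c (q n) j / l j * l i" for n i
    have c'j: "c' n j = 0" for n using jJ by (simp add: c'_def)
    have "0 \<le> c' n i" if "i \<in> J" for n i
    proof (cases "i \<in> P")
      case True
      then show ?thesis using k(2)[of i "q n"] q(2)[of n] by (simp add: c'_def P_def field_simps)
    next
      case False
      then have "l i = 0" using that lnn[of i] by (auto simp: P_def)
      then show ?thesis using nonneg[OF that] by (simp add: c'_def)
    qed
    moreover have "(\<lambda>n. \<Sum>i\<in>J - {j}. c' n i * v i e) \<longlonglongrightarrow> b e" if "e \<in> I" for e
    proof -
      have "(\<Sum>i\<in>J - {j}. c' n i * v i e) = (\<Sum>i\<in>J. c (q n) i * v i e)" for n
      proof -
        have "(\<Sum>i\<in>J - {j}. c' n i * v i e) = (\<Sum>i\<in>J. c' n i * v i e)"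
          using sum.remove[OF fin jJ(1), of "\<lambda>i. c' n i * v i e"] c'j by simp
        also have "\<dots> = (\<Sum>i\<in>J. c (q n) i * v i e) - c (q n) j / l j * (\<Sum>i\<in>J. l i * v i e)"
          by (simp add: c'_def left_diff_distrib sum_subtractf sum_distrib_left mult.assoc)
        finally show ?thesis using l0[OF that] by simp
      qed
      then show ?thesis
        using LIMSEQ_subseq_LIMSEQ[OF lim[OF that] q(1)] by (simp add: o_def)
    qed
    moreover have "card (J - {j}) < card J" using fin jJ by (intro psubset_card_mono) auto
    ultimately have "\<exists>d. (\<forall>i\<in>J - {j}. 0 \<le> d i) \<and>
        (\<forall>e\<in>I. (\<Sum>i\<in>J - {j}. d i * v i e) = b e)"
      using fin by (intro less.hyps[where c = c']) auto
    then obtain d where d: "\<forall>i\<in>J - {j}. 0 \<le> d i"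
      "\<forall>e\<in>I. (\<Sum>i\<in>J - {j}. d i * v i e) = b e" by (elim exE conjE)
    have "(\<Sum>i\<in>J. (d(j := 0)) i * v i e) = b e" if "e \<in> I" for e
      using bspec[OF d(2) that] sum.remove[OF fin jJ(1), of "\<lambda>i. (d(j := 0)) i * v i e"] by simp
    then show ?thesis using d(1) by (intro exI[of _ "d(j := 0)"]) auto
  qed
qed

text \<open>Slack variables reduce this to equalities: \<open>J <+> I\<close> adds one unit vector
  per constraint, with the gap between the two sides as its coefficient.\<close>

lemma closed_finite_cone_le:
  fixes c :: "nat \<Rightarrow> 'j \<Rightarrow> real" and v :: "'j \<Rightarrow> 'i \<Rightarrow> real"
  assumes "finite J" "finite I" and nonneg: "\<And>n j. j \<in> J \<Longrightarrow> 0 \<le> c n j"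
    and le: "\<And>n i. i \<in> I \<Longrightarrow> (\<Sum>j\<in>J. c n j * v j i) \<le> b n i"
    and lim: "\<And>i. i \<in> I \<Longrightarrow> (\<lambda>n. b n i) \<longlonglongrightarrow> b' i"
  obtains c' where "\<And>j. j \<in> J \<Longrightarrow> 0 \<le> c' j" "\<And>i. i \<in> I \<Longrightarrow> (\<Sum>j\<in>J. c' j * v j i) \<le> b' i"
proof -
  define w where "w = case_sum v (\<lambda>i i'. of_bool (i = i') :: real)"
  define e where "e n = case_sum (c n) (\<lambda>i. b n i - (\<Sum>j\<in>J. c n j * v j i))" for n
  have "\<exists>c'. (\<forall>j\<in>J <+> I. 0 \<le> c' j) \<and> (\<forall>i\<in>I. (\<Sum>j\<in>J <+> I. c' j * w j i) = b' i)"
  proof (rule closed_finite_cone[where c = e])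
    show "finite (J <+> I)" using assms by simp
    show "0 \<le> e n j" if "j \<in> J <+> I" for n j
      using that nonneg le by (auto simp: e_def)
    show "(\<lambda>n. \<Sum>j\<in>J <+> I. e n j * w j i) \<longlonglongrightarrow> b' i" if "i \<in> I" for i
      using lim[OF that] that assms(1,2) by (simp add: sum.Plus e_def w_def)
  qed
  then obtain c' where c': "\<forall>j\<in>J <+> I. 0 \<le> c' j"
    "\<forall>i\<in>I. (\<Sum>j\<in>J <+> I. c' j * w j i) = b' i" by (elim exE conjE)
  show thesis
  proof (rule that[of "\<lambda>j. c' (Inl j)"])
    show "(\<Sum>j\<in>J. c' (Inl j) * v j i) \<le> b' i" if "i \<in> I" for i
      using bspec[OF c'(2) that] bspec[OF c'(1) InrI[OF that]] that assms(1,2) by (simp add: sum.Plus w_def)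
  qed (use c' in auto)
qed

section \<open>Visit probabilities\<close>

text \<open>Successors are taken from \<open>states M\<close> only, because \<open>mdp\<close>
  constrains no transition values outside it.\<close>

definition closed_states :: "('s, 'a, 'm) mdp_scheme \<Rightarrow> 's set \<Rightarrow> bool" where
  "closed_states M Y \<longleftrightarrow> Y \<subseteq> states M \<and>
    (\<forall>s\<in>Y. \<forall>a\<in>allowed M s. \<forall>s'\<in>states M - Y. trans_prob M s a s' = 0)"

context mdp
begin

lemma finite_allowed: "s \<in> states M \<Longrightarrow> finite (allowed M s)"
  using allowed_subset finite_actions finite_subset by blast

lemma trans_prob_nonneg:
  assumes "s \<in> states M" "a \<in> allowed M s" "s' \<in> states M"
  shows "0 \<le> trans_prob M s a s'"
  using trans_range[of s a s'] allowed_subset[of s] assms by auto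

lemma trans_prob_sum_1:
  assumes "s \<in> states M" "a \<in> allowed M s"
  shows "(\<Sum>s'\<in>states M. trans_prob M s a s') = 1"
  using trans_sum[of s a] allowed_subset[of s] assms by auto

lemma sum_sa_pairs: "(\<Sum>z\<in>sa_pairs M. f z) = (\<Sum>s\<in>states M. \<Sum>a\<in>allowed M s. f (s, a))"
  unfolding sa_pairs_def using finite_states finite_allowed by (subst sum.Sigma) auto

text \<open>Comparing with an extensional restriction makes the candidates \<open>x\<close> range
  over a finite set of functions, and each event a cylinder.\<close>

definition prefix_prob :: "('s, 'a) policy \<Rightarrow> nat \<Rightarrow> (nat \<Rightarrow> 's \<times> 'a) \<Rightarrow> real" where
  "prefix_prob \<pi> n x = \<P>(\<omega> in traj_measure M \<pi>. restrict \<omega> {0..<n} = x)"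

definition pair_prob :: "('s, 'a) policy \<Rightarrow> nat \<Rightarrow> 's \<times> 'a \<Rightarrow> real" where
  "pair_prob \<pi> t z = \<P>(\<omega> in traj_measure M \<pi>. \<omega> t = z)"

definition visit_prob :: "('s, 'a) policy \<Rightarrow> nat \<Rightarrow> 's \<Rightarrow> real" where
  "visit_prob \<pi> t s = \<P>(\<omega> in traj_measure M \<pi>. fst (\<omega> t) = s)"

context
  fixes \<pi> :: "('s, 'a) policy"
  assumes \<pi>: "is_policy M \<pi>"
begin

interpretation T: prob_space "traj_measure M \<pi>"
  using \<pi> by (rule prob_space_traj_measure)

abbreviation "prefix_set n \<equiv> {0..<n::nat} \<rightarrow>\<^sub>E sa_pairs M"

lemma finite_prefixes: "finite (prefix_set n)"
  by (simp add: finite_PiE finite_sa_pairs)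

text \<open>Restriction to finitely many times is measurable into a finite discrete space, where
  every predicate \<open>R\<close> defines an event.\<close>

lemma sets_prefix:
  "{\<omega> \<in> space (traj_measure M \<pi>). R (restrict \<omega> {0..<n})} \<in> sets (traj_measure M \<pi>)"
proof -
  let ?N = "PiM UNIV (\<lambda>_::nat. count_space (sa_pairs M))"
  have P: "PiM {0..<n} (\<lambda>_. count_space (sa_pairs M)) = count_space (prefix_set n)"
    by (rule count_space_PiM_finite) (auto intro: countable_finite finite_sa_pairs)
  have "(\<lambda>\<omega>. restrict \<omega> {0..<n}) \<in> measurable ?N (count_space (prefix_set n))"
    unfolding P[symmetric] by (rule measurable_restrict_subset) simp
  then have "(\<lambda>\<omega>. restrict \<omega> {0..<n}) -` {x\<in>prefix_set n. R x} \<inter> space ?N \<in> sets ?N"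
    by (rule measurable_sets) auto
  also have "(\<lambda>\<omega>. restrict \<omega> {0..<n}) -` {x\<in>prefix_set n. R x} \<inter> space ?N
      = {\<omega> \<in> space ?N. R (restrict \<omega> {0..<n})}"
    by (auto simp: space_PiM)
  finally show ?thesis
    using sets_traj_measure[OF \<pi>] sets_eq_imp_space_eq[OF sets_traj_measure[OF \<pi>]] by simp
qed

lemma sets_prefix_Suc:
  "{\<omega> \<in> space (traj_measure M \<pi>). R (restrict \<omega> {0..<n}) (\<omega> n)} \<in> sets (traj_measure M \<pi>)"
proof -
  have "restrict (restrict \<omega> {0..<Suc n}) {0..<n} = restrict \<omega> {0..<n}" for \<omega> :: "nat \<Rightarrow> 's \<times> 'a"
    by auto
  then show ?thesis
    using sets_prefix[of "\<lambda>x. R (restrict x {0..<n}) (x n)" "Suc n"] by simp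
qed

lemma sets_component:
  "{\<omega> \<in> space (traj_measure M \<pi>). R (\<omega> n)} \<in> sets (traj_measure M \<pi>)"
  using sets_prefix_Suc[of "\<lambda>_. R"] .

lemma prob_split:
  assumes "finite V" and "\<And>\<omega>. \<omega> \<in> space (traj_measure M \<pi>) \<Longrightarrow> Q \<omega> \<Longrightarrow> F \<omega> \<in> V"
    and "\<And>v. v \<in> V \<Longrightarrow> {\<omega> \<in> space (traj_measure M \<pi>). Q \<omega> \<and> F \<omega> = v} \<in> sets (traj_measure M \<pi>)"
  shows "\<P>(\<omega> in traj_measure M \<pi>. Q \<omega>)
    = (\<Sum>v\<in>V. \<P>(\<omega> in traj_measure M \<pi>. Q \<omega> \<and> F \<omega> = v))"
proof -
  have "{\<omega> \<in> space (traj_measure M \<pi>). Q \<omega>}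
      = (\<Union>v\<in>V. {\<omega> \<in> space (traj_measure M \<pi>). Q \<omega> \<and> F \<omega> = v})"
    using assms(2) by auto
  moreover have "T.prob (\<Union>v\<in>V. {\<omega> \<in> space (traj_measure M \<pi>). Q \<omega> \<and> F \<omega> = v})
      = (\<Sum>v\<in>V. \<P>(\<omega> in traj_measure M \<pi>. Q \<omega> \<and> F \<omega> = v))"
    using assms(1,3) by (intro T.finite_measure_finite_Union) (auto simp: disjoint_family_on_def)
  ultimately show ?thesis by simp
qed

lemma space_traj_in:
  assumes "\<omega> \<in> space (traj_measure M \<pi>)"
  shows "\<omega> t \<in> sa_pairs M" "fst (\<omega> t) \<in> states M" "snd (\<omega> t) \<in> allowed M (fst (\<omega> t))"
    "restrict \<omega> {0..<n} \<in> prefix_set n"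
proof -
  have *: "\<omega> i \<in> sa_pairs M" for i
    using assms unfolding space_traj_measure[OF \<pi>] by auto
  then show "\<omega> t \<in> sa_pairs M" "restrict \<omega> {0..<n} \<in> prefix_set n" by auto
  show "fst (\<omega> t) \<in> states M" "snd (\<omega> t) \<in> allowed M (fst (\<omega> t))"
    using *[of t] by (cases "\<omega> t"; simp add: sa_pairs_def)+
qed

text \<open>Both events are cylinders, so their probabilities are products of kernel factors. The
  factor at \<open>i\<close> reads only indices below \<open>i\<close> besides the pair at
  \<open>i\<close> itself, so extending the prefix at \<open>n\<close> leaves the first
  \<open>n\<close> factors unchanged.\<close>

lemma prob_prefix_step:
  assumes x: "x \<in> prefix_set n" and s: "s \<in> states M" and a: "a \<in> allowed M s"
  shows "\<P>(\<omega> in traj_measure M \<pi>. restrict \<omega> {0..<n} = x \<and> \<omega> n = (s, a))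
    = prefix_prob \<pi> n x * (state_prob M n x s * pmf (\<pi> (map x [0..<n]) s) a)"
proof -
  let ?S = "space (traj_measure M \<pi>)" and ?y = "x(n := (s, a))"
  let ?p = "\<lambda>x i. ennreal (state_prob M i x (fst (x i)) *
    pmf (\<pi> (map x [0..<i]) (fst (x i))) (snd (x i)))"
  have xin: "x i \<in> sa_pairs M" if "i < n" for i using x that by auto
  have za: "(s, a) \<in> sa_pairs M" using s a by (simp add: sa_pairs_def)
  have 1: "{\<omega>\<in>?S. restrict \<omega> {0..<n} = x} = {\<omega>\<in>?S. \<forall>i<n. \<omega> i = x i}"
    using x by (auto simp: fun_eq_iff PiE_iff extensional_def restrict_def)
  have 2: "{\<omega>\<in>?S. restrict \<omega> {0..<n} = x \<and> \<omega> n = (s, a)} = {\<omega>\<in>?S. \<forall>i<Suc n. \<omega> i = ?y i}"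
    using x by (auto simp: fun_eq_iff PiE_iff extensional_def restrict_def less_Suc_eq)
  have sp: "state_prob M i ?y = state_prob M i x" if "i \<le> n" for i
    using that by (auto simp: state_prob_def fun_eq_iff split: nat.split)
  have mp: "map ?y [0..<i] = map x [0..<i]" if "i \<le> n" for i
    using that by (auto simp: map_eq_conv)
  have nn: "0 \<le> state_prob M n x s * pmf (\<pi> (map x [0..<n]) s) a"
    using x s by (intro mult_nonneg_nonneg state_prob_nonneg) auto
  have "ennreal (\<P>(\<omega> in traj_measure M \<pi>. restrict \<omega> {0..<n} = x \<and> \<omega> n = (s, a)))
      = (\<Prod>i<Suc n. ?p ?y i)"
    unfolding 2 T.emeasure_eq_measure[symmetric]
    using xin za by (intro emeasure_traj_measure_cylinder[OF \<pi>]) (auto simp: less_Suc_eq)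
  also have "\<dots> = (\<Prod>i<n. ?p ?y i) * ?p ?y n" by (rule prod.lessThan_Suc)
  also have "(\<Prod>i<n. ?p ?y i) = (\<Prod>i<n. ?p x i)"
    using sp mp by (intro prod.cong refl) simp
  also have "\<dots> = ennreal (prefix_prob \<pi> n x)"
    unfolding prefix_prob_def 1 T.emeasure_eq_measure[symmetric]
    using emeasure_traj_measure_cylinder[OF \<pi> xin] by simp
  also have "?p ?y n = ennreal (state_prob M n x s * pmf (\<pi> (map x [0..<n]) s) a)"
    using sp[of n] mp[of n] by simp
  finally have "ennreal (\<P>(\<omega> in traj_measure M \<pi>. restrict \<omega> {0..<n} = x \<and> \<omega> n = (s, a)))
      = ennreal (prefix_prob \<pi> n x * (state_prob M n x s * pmf (\<pi> (map x [0..<n]) s) a))"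
    unfolding ennreal_mult''[OF nn] .
  then show ?thesis
    by (subst (asm) ennreal_inj) (use nn in \<open>auto simp: prefix_prob_def\<close>)
qed

lemma prob_prefix_pair:
  assumes s: "s \<in> states M" and a: "a \<in> allowed M s"
  shows "\<P>(\<omega> in traj_measure M \<pi>. R (restrict \<omega> {0..<n}) \<and> \<omega> n = (s, a))
    = (\<Sum>x | x \<in> prefix_set n \<and> R x. prefix_prob \<pi> n x * (state_prob M n x s * pmf (\<pi> (map x [0..<n]) s) a))"
proof -
  have "\<P>(\<omega> in traj_measure M \<pi>. R (restrict \<omega> {0..<n}) \<and> \<omega> n = (s, a))
    = (\<Sum>x | x \<in> prefix_set n \<and> R x.
        \<P>(\<omega> in traj_measure M \<pi>. (R (restrict \<omega> {0..<n}) \<and> \<omega> n = (s, a)) \<and> restrict \<omega> {0..<n} = x))"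
    using finite_prefixes[of n] space_traj_in(4) sets_prefix_Suc[of _ n]
    by (intro prob_split) auto
  also have "\<dots> = (\<Sum>x | x \<in> prefix_set n \<and> R x.
        \<P>(\<omega> in traj_measure M \<pi>. restrict \<omega> {0..<n} = x \<and> \<omega> n = (s, a)))"
    by (intro sum.cong refl arg_cong[where f = T.prob]) auto
  also have "\<dots> = (\<Sum>x | x \<in> prefix_set n \<and> R x.
        prefix_prob \<pi> n x * (state_prob M n x s * pmf (\<pi> (map x [0..<n]) s) a))"
    using prob_prefix_step[OF _ s a] by (intro sum.cong) auto
  finally show ?thesis .
qed

lemma prob_prefix_state:
  assumes s: "s \<in> states M"
  shows "\<P>(\<omega> in traj_measure M \<pi>. R (restrict \<omega> {0..<n}) \<and> fst (\<omega> n) = s)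
    = (\<Sum>x | x \<in> prefix_set n \<and> R x. prefix_prob \<pi> n x * state_prob M n x s)"
proof -
  have "\<P>(\<omega> in traj_measure M \<pi>. R (restrict \<omega> {0..<n}) \<and> fst (\<omega> n) = s)
    = (\<Sum>a\<in>allowed M s.
        \<P>(\<omega> in traj_measure M \<pi>. (R (restrict \<omega> {0..<n}) \<and> fst (\<omega> n) = s) \<and> snd (\<omega> n) = a))"
    using finite_allowed[OF s] space_traj_in(3)[of _ n] sets_prefix_Suc[of _ n]
    by (intro prob_split) auto
  also have "\<dots> = (\<Sum>a\<in>allowed M s. \<P>(\<omega> in traj_measure M \<pi>. R (restrict \<omega> {0..<n}) \<and> \<omega> n = (s, a)))"
    by (intro sum.cong refl arg_cong[where f = T.prob]) (auto simp: prod_eq_iff)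
  also have "\<dots> = (\<Sum>a\<in>allowed M s. \<Sum>x | x \<in> prefix_set n \<and> R x.
      prefix_prob \<pi> n x * (state_prob M n x s * pmf (\<pi> (map x [0..<n]) s) a))"
    using prob_prefix_pair[OF s] by (intro sum.cong) auto
  also have "\<dots> = (\<Sum>x | x \<in> prefix_set n \<and> R x. prefix_prob \<pi> n x * state_prob M n x s *
      (\<Sum>a\<in>allowed M s. pmf (\<pi> (map x [0..<n]) s) a))"
    by (subst sum.swap) (simp add: sum_distrib_left mult.assoc)
  also have "\<dots> = (\<Sum>x | x \<in> prefix_set n \<and> R x. prefix_prob \<pi> n x * state_prob M n x s)"
  \<comment> \<open>A prefix is a history over \<open>sa_pairs M\<close>, the only kind that
    \<open>is_policy\<close> constrains; there the action weights sum to one.\<close>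
  proof (intro sum.cong refl)
    fix x assume "x \<in> {x. x \<in> prefix_set n \<and> R x}"
    then have "x i \<in> sa_pairs M" if "i < n" for i using that by auto
    then have "map x [0..<n] \<in> lists (sa_pairs M)" by (auto simp: in_lists_conv_set)
    then show "prefix_prob \<pi> n x * state_prob M n x s * (\<Sum>a\<in>allowed M s. pmf (\<pi> (map x [0..<n]) s) a)
        = prefix_prob \<pi> n x * state_prob M n x s"
      using \<pi> s finite_allowed[OF s] by (simp add: sum_pmf_eq_1 is_policy_def)
  qed
  finally show ?thesis .
qed

lemma visit_prob_eq_sum:
  assumes "s \<in> states M"
  shows "visit_prob \<pi> n s = (\<Sum>x\<in>prefix_set n. prefix_prob \<pi> n x * state_prob M n x s)"
  using prob_prefix_state[OF assms, where R = "\<lambda>_. True"] by (simp add: visit_prob_def)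

lemma visit_prob_0:
  assumes "s \<in> states M"
  shows "visit_prob \<pi> 0 s = pmf (init_dist M) s"
proof -
  \<comment> \<open>The empty prefix is the only element of \<open>prefix_set 0\<close>.\<close>
  have "prefix_prob \<pi> 0 (\<lambda>_. undefined) = 1"
    by (simp add: prefix_prob_def restrict_def T.prob_space)
  then show ?thesis using visit_prob_eq_sum[OF assms, of 0] by (simp add: state_prob_def)
qed

lemma pair_prob_eq_sum:
  assumes "z \<in> sa_pairs M"
  shows "pair_prob \<pi> t z = (\<Sum>x | x \<in> prefix_set (Suc t) \<and> x t = z. prefix_prob \<pi> (Suc t) x)"
proof -
  have "pair_prob \<pi> t z = (\<Sum>x | x \<in> prefix_set (Suc t) \<and> x t = z.
      \<P>(\<omega> in traj_measure M \<pi>. \<omega> t = z \<and> restrict \<omega> {0..<Suc t} = x))"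
    unfolding pair_prob_def
  proof (intro prob_split)
    show "{\<omega> \<in> space (traj_measure M \<pi>). \<omega> t = z \<and> restrict \<omega> {0..<Suc t} = v} \<in> T.events" for v
      using sets_prefix[of "\<lambda>x. x t = z \<and> x = v" "Suc t"] by simp
  qed (use finite_prefixes[of "Suc t"] space_traj_in(4)[of _ "Suc t"] in auto)
  also have "\<dots> = (\<Sum>x | x \<in> prefix_set (Suc t) \<and> x t = z. prefix_prob \<pi> (Suc t) x)"
    unfolding prefix_prob_def by (intro sum.cong refl arg_cong[where f = T.prob]) auto
  finally show ?thesis .
qed

text \<open>The transition kernel sees only the last pair, even if the policy looks at the whole
  history. Grouping the prefixes by that pair gives a linear recursion on one-time marginals, valid
  for every policy.\<close>

lemma visit_prob_Suc:
  assumes "s \<in> states M"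
  shows "visit_prob \<pi> (Suc t) s = (\<Sum>(s', a)\<in>sa_pairs M. pair_prob \<pi> t (s', a) * trans_prob M s' a s)"
proof -
  have "visit_prob \<pi> (Suc t) s = (\<Sum>x\<in>prefix_set (Suc t).
      prefix_prob \<pi> (Suc t) x * trans_prob M (fst (x t)) (snd (x t)) s)"
    using visit_prob_eq_sum[OF assms] by (simp add: state_prob_def)
  also have "\<dots> = (\<Sum>z\<in>sa_pairs M. \<Sum>x | x \<in> prefix_set (Suc t) \<and> x t = z.
      prefix_prob \<pi> (Suc t) x * trans_prob M (fst (x t)) (snd (x t)) s)"
    by (rule sum.group[symmetric]) (auto simp: finite_prefixes finite_sa_pairs)
  also have "\<dots> = (\<Sum>(s', a)\<in>sa_pairs M. pair_prob \<pi> t (s', a) * trans_prob M s' a s)"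
    by (intro sum.cong refl) (auto simp: pair_prob_eq_sum sum_distrib_right)
  finally show ?thesis .
qed

lemma sum_pair_prob:
  assumes "s \<in> states M"
  shows "(\<Sum>a\<in>allowed M s. pair_prob \<pi> t (s, a)) = visit_prob \<pi> t s"
proof -
  have "visit_prob \<pi> t s = (\<Sum>a\<in>allowed M s. \<P>(\<omega> in traj_measure M \<pi>. fst (\<omega> t) = s \<and> snd (\<omega> t) = a))"
    unfolding visit_prob_def
    using finite_allowed[OF assms] space_traj_in(3)[of _ t] sets_component[of _ t]
    by (intro prob_split) auto
  also have "\<dots> = (\<Sum>a\<in>allowed M s. pair_prob \<pi> t (s, a))"
    unfolding pair_prob_def by (intro sum.cong refl arg_cong[where f = T.prob]) (auto simp: prod_eq_iff)
  finally show ?thesis ..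
qed

text \<open>The action factor no longer depends on the prefix and leaves the sum. Together with
  \<open>visit_prob_Suc\<close> this makes the state marginals evolve as a Markov chain.\<close>

lemma pair_prob_stationary:
  assumes d: "\<And>h s. h \<in> lists (sa_pairs M) \<Longrightarrow> s \<in> states M \<Longrightarrow> \<pi> h s = d s"
    and s: "s \<in> states M" and a: "a \<in> allowed M s"
  shows "pair_prob \<pi> t (s, a) = visit_prob \<pi> t s * pmf (d s) a"
proof -
  have "pair_prob \<pi> t (s, a)
      = (\<Sum>x\<in>prefix_set t. prefix_prob \<pi> t x * (state_prob M t x s * pmf (\<pi> (map x [0..<t]) s) a))"
    using prob_prefix_pair[OF s a, where R = "\<lambda>_. True"] by (simp add: pair_prob_def)
  also have "\<dots> = (\<Sum>x\<in>prefix_set t. prefix_prob \<pi> t x * state_prob M t x s * pmf (d s) a)"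
  proof (intro sum.cong refl)
    fix x assume "x \<in> prefix_set t"
    then have "x i \<in> sa_pairs M" if "i < t" for i using that by auto
    then have "map x [0..<t] \<in> lists (sa_pairs M)" by (auto simp: in_lists_conv_set)
    then show "prefix_prob \<pi> t x * (state_prob M t x s * pmf (\<pi> (map x [0..<t]) s) a)
      = prefix_prob \<pi> t x * state_prob M t x s * pmf (d s) a"
      using d s by simp
  qed
  also have "\<dots> = visit_prob \<pi> t s * pmf (d s) a"
    using visit_prob_eq_sum[OF s] by (simp add: sum_distrib_right)
  finally show ?thesis .
qed

text \<open>Leaving \<open>Y\<close> means moving to one of finitely many outside states, each by a
  transition of probability zero, and finitely many null events have a null union.\<close>

lemma AE_closed_states:
  assumes Y: "closed_states M Y"
  shows "AE \<omega> in traj_measure M \<pi>. fst (\<omega> t) \<in> Y \<longrightarrow> fst (\<omega> (Suc t)) \<in> Y"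
proof -
  let ?B = "\<lambda>s. {\<omega> \<in> space (traj_measure M \<pi>). fst (\<omega> t) \<in> Y \<and> fst (\<omega> (Suc t)) = s}"
  have ev: "?B s \<in> T.events" for s
    using sets_prefix_Suc[of "\<lambda>x z. fst (x t) \<in> Y \<and> fst z = s" "Suc t"] by simp
  have "AE \<omega> in traj_measure M \<pi>. \<not> (fst (\<omega> t) \<in> Y \<and> fst (\<omega> (Suc t)) = s)" if s: "s \<in> states M - Y" for s
  proof -
    have "T.prob (?B s)
      = (\<Sum>x | x \<in> prefix_set (Suc t) \<and> fst (x t) \<in> Y. prefix_prob \<pi> (Suc t) x * state_prob M (Suc t) x s)"
      using prob_prefix_state[of s "\<lambda>x. fst (x t) \<in> Y" "Suc t"] s by simp
    also have "\<dots> = 0"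
    proof (intro sum.neutral ballI)
      fix x assume x: "x \<in> {x. x \<in> prefix_set (Suc t) \<and> fst (x t) \<in> Y}"
      then have "x t \<in> sa_pairs M" by auto
      then have "snd (x t) \<in> allowed M (fst (x t))" by (auto simp: sa_pairs_def)
      then show "prefix_prob \<pi> (Suc t) x * state_prob M (Suc t) x s = 0"
        using Y s x by (auto simp: closed_states_def state_prob_def)
    qed
    finally have "emeasure (traj_measure M \<pi>) (?B s) = 0" by (simp add: T.emeasure_eq_measure)
    then show ?thesis using ev by (intro AE_I[of _ _ "?B s"]) auto
  qed
  then have "AE \<omega> in traj_measure M \<pi>. \<forall>s\<in>states M - Y. \<not> (fst (\<omega> t) \<in> Y \<and> fst (\<omega> (Suc t)) = s)"
    using finite_states by (intro AE_finite_allI) auto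
  with AE_space show ?thesis
    by eventually_elim (use space_traj_in(2) in blast)
qed

text \<open>By absorption, being in \<open>Y\<close> at time \<open>t\<close> agrees almost surely
  with having hit \<open>Y\<close> by time \<open>t\<close>. The latter events increase to the
  reachability event, so continuity from below applies.\<close>

lemma visit_prob_tendsto_reach_prob:
  assumes Y: "closed_states M Y"
  shows "(\<lambda>t. \<Sum>s\<in>Y. visit_prob \<pi> t s) \<longlonglongrightarrow> reach_prob M \<pi> Y"
proof -
  let ?S = "space (traj_measure M \<pi>)"
  let ?A = "\<lambda>t. {\<omega>\<in>?S. \<exists>i\<le>t. fst (\<omega> i) \<in> Y}"
  have finY: "finite Y" using Y finite_states by (auto simp: closed_states_def intro: finite_subset)
  have evA: "?A t \<in> T.events" for t
  proof -
    have "?A t = {\<omega>\<in>?S. \<exists>i\<le>t. fst (restrict \<omega> {0..<Suc t} i) \<in> Y}"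
      by (intro Collect_cong conj_cong refl ex_cong) auto
    then show ?thesis using sets_prefix[of "\<lambda>x. \<exists>i\<le>t. fst (x i) \<in> Y" "Suc t"] by (simp only:)
  qed
  have "(\<Sum>s\<in>Y. visit_prob \<pi> t s) = T.prob (?A t)" for t
  proof -
    have "AE \<omega> in traj_measure M \<pi>. \<forall>t. fst (\<omega> t) \<in> Y \<longrightarrow> fst (\<omega> (Suc t)) \<in> Y"
      using AE_closed_states[OF Y] by (simp add: AE_all_countable)
    then have "AE \<omega> in traj_measure M \<pi>. \<omega> \<in> {\<omega>\<in>?S. fst (\<omega> t) \<in> Y} \<longleftrightarrow> \<omega> \<in> ?A t"
    proof eventually_elim
      case (elim \<omega>)
      have "fst (\<omega> j) \<in> Y" if "fst (\<omega> i) \<in> Y" "i \<le> j" for i j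
        using that(2,1) by (induction rule: dec_induct) (use elim in auto)
      then show ?case by auto
    qed
    then have "T.prob (?A t) = T.prob {\<omega>\<in>?S. fst (\<omega> t) \<in> Y}"
      by (intro T.finite_measure_eq_AE[symmetric] evA sets_component)
    also have "\<dots> = (\<Sum>s\<in>Y. \<P>(\<omega> in traj_measure M \<pi>. fst (\<omega> t) \<in> Y \<and> fst (\<omega> t) = s))"
      using finY sets_component[of _ t] by (intro prob_split) auto
    also have "\<dots> = (\<Sum>s\<in>Y. visit_prob \<pi> t s)"
      unfolding visit_prob_def by (intro sum.cong refl arg_cong[where f = T.prob]) auto
    finally show ?thesis ..
  qed
  moreover have "(\<lambda>t. T.prob (?A t)) \<longlonglongrightarrow> T.prob (\<Union>t. ?A t)"
  proof (rule T.finite_Lim_measure_incseq)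
    show "range ?A \<subseteq> T.events" using evA by blast
    show "incseq ?A" unfolding incseq_def using le_trans by blast
  qed
  moreover have "(\<Union>t. ?A t) = {\<omega>\<in>?S. reaches (path \<omega>) Y}"
    by (auto simp: reaches_def path_def)
  ultimately show ?thesis by (simp add: reach_prob_def)
qed

end

end

section \<open>Occupation flows and stationary policies\<close>

lemma pmf_of_finite_weights:
  fixes f :: "'a \<Rightarrow> real"
  assumes "finite A" "\<And>a. a \<in> A \<Longrightarrow> 0 \<le> f a" "sum f A = 1"
  shows "\<exists>p. set_pmf p \<subseteq> A \<and> (\<forall>a\<in>A. pmf p a = f a)"
proof -
  let ?g = "\<lambda>a. if a \<in> A then f a else 0"
  have nonneg: "0 \<le> ?g a" for a using assms(2) by simp
  have "(\<integral>\<^sup>+a. ennreal (?g a) \<partial>count_space UNIV) = (\<Sum>a\<in>A. ennreal (?g a))"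
    using assms(1) by (intro nn_integral_count_space') auto
  also have "\<dots> = 1" using assms(2,3) by (simp add: sum_ennreal)
  finally have one: "(\<integral>\<^sup>+a. ennreal (?g a) \<partial>count_space UNIV) = 1" .
  show ?thesis
    by (intro exI[of _ "embed_pmf ?g"])
      (auto simp: pmf_embed_pmf[OF nonneg one] set_embed_pmf[OF nonneg one])
qed

text \<open>The value is 0 inside \<open>Y\<close> so that mass already absorbed by a closed
  \<open>Y\<close> is not counted again at later steps.\<close>

definition entry_prob :: "('s, 'a, 'm) mdp_scheme \<Rightarrow> 's set \<Rightarrow> 's \<times> 'a \<Rightarrow> real" where
  "entry_prob M Y = (\<lambda>(s, a). if s \<in> Y then 0 else (\<Sum>s'\<in>Y. trans_prob M s a s'))"

context mdp
begin

section \<open>Mass balance of closed sets\<close>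

lemma sa_pairsD:
  assumes "z \<in> sa_pairs M"
  shows "fst z \<in> states M" "snd z \<in> allowed M (fst z)"
  using assms by (auto simp: sa_pairs_def)

lemma closed_states_states: "closed_states M (states M)"
  by (simp add: closed_states_def)

lemma entry_prob_nonneg:
  assumes "Y \<subseteq> states M" "z \<in> sa_pairs M"
  shows "0 \<le> entry_prob M Y z"
  using assms trans_prob_nonneg
  by (auto simp: entry_prob_def sa_pairs_def split_beta intro!: sum_nonneg)

lemma sum_trans_prob_closed:
  assumes Y: "closed_states M Y" and s: "s \<in> states M" and a: "a \<in> allowed M s"
  shows "(\<Sum>s'\<in>Y. trans_prob M s a s') = entry_prob M Y (s, a) + of_bool (s \<in> Y)"
proof (cases "s \<in> Y")
  case True
  then have "(\<Sum>s'\<in>Y. trans_prob M s a s') = (\<Sum>s'\<in>states M. trans_prob M s a s')"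
    using Y a finite_states by (intro sum.mono_neutral_left) (auto simp: closed_states_def)
  then show ?thesis using True trans_prob_sum_1[OF s a] by (simp add: entry_prob_def)
qed (simp add: entry_prob_def)

text \<open>After one step, \<open>Y\<close> holds the mass it had plus what enters, since nothing
  leaves. The weights \<open>x\<close> are arbitrary, so this serves both true pair probabilities
  and abstract flows.\<close>

lemma sum_over_closed_step:
  assumes Y: "closed_states M Y"
  shows "(\<Sum>s'\<in>Y. \<Sum>(s, a)\<in>sa_pairs M. x (s, a) * trans_prob M s a s')
    = (\<Sum>s\<in>Y. \<Sum>a\<in>allowed M s. x (s, a)) + (\<Sum>z\<in>sa_pairs M. x z * entry_prob M Y z)"
proof -
  have "(\<Sum>s'\<in>Y. \<Sum>(s, a)\<in>sa_pairs M. x (s, a) * trans_prob M s a s')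
      = (\<Sum>z\<in>sa_pairs M. x z * (\<Sum>s'\<in>Y. trans_prob M (fst z) (snd z) s'))"
    by (subst sum.swap) (simp add: split_beta sum_distrib_left)
  also have "\<dots> = (\<Sum>z\<in>sa_pairs M. x z * entry_prob M Y z + of_bool (fst z \<in> Y) * x z)"
    using sum_trans_prob_closed[OF Y sa_pairsD] by (intro sum.cong) (auto simp: distrib_left)
  also have "\<dots> = (\<Sum>z\<in>sa_pairs M. x z * entry_prob M Y z)
      + (\<Sum>s\<in>states M. of_bool (s \<in> Y) * (\<Sum>a\<in>allowed M s. x (s, a)))"
    by (simp add: sum.distrib sum_sa_pairs sum_distrib_left)
  also have "(\<Sum>s\<in>states M. of_bool (s \<in> Y) * (\<Sum>a\<in>allowed M s. x (s, a)))
      = (\<Sum>s\<in>Y. of_bool (s \<in> Y) * (\<Sum>a\<in>allowed M s. x (s, a)))"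
    using Y finite_states by (intro sum.mono_neutral_right) (auto simp: closed_states_def)
  finally show ?thesis by simp
qed

lemma visit_prob_closed_Suc:
  assumes \<pi>: "is_policy M \<pi>" and Y: "closed_states M Y"
  shows "(\<Sum>s\<in>Y. visit_prob \<pi> (Suc t) s)
    = (\<Sum>s\<in>Y. visit_prob \<pi> t s) + (\<Sum>z\<in>sa_pairs M. pair_prob \<pi> t z * entry_prob M Y z)"
proof -
  have Ys: "s \<in> states M" if "s \<in> Y" for s using Y that by (auto simp: closed_states_def)
  then show ?thesis
    using sum_over_closed_step[OF Y, of "pair_prob \<pi> t"]
    by (simp add: visit_prob_Suc[OF \<pi>] sum_pair_prob[OF \<pi>])
qed

text \<open>Truncation at \<open>n\<close> keeps the counts finite: under a policy they add up to
  \<open>n\<close> over all pairs, so the untruncated counts cannot all be finite.\<close>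

definition occupation :: "('s, 'a) policy \<Rightarrow> nat \<Rightarrow> 's \<times> 'a \<Rightarrow> real" where
  "occupation \<pi> n z = (\<Sum>t<n. pair_prob \<pi> t z)"

lemma occupation_nonneg: "0 \<le> occupation \<pi> n z"
  by (simp add: occupation_def pair_prob_def sum_nonneg)

text \<open>Departures are counted at times below \<open>n\<close>, arrivals up to time
  \<open>n\<close>; the slack is the probability of visiting \<open>s\<close> at time
  \<open>n\<close>.\<close>

lemma occupation_flow:
  assumes \<pi>: "is_policy M \<pi>" and s: "s \<in> states M"
  shows "(\<Sum>a\<in>allowed M s. occupation \<pi> n (s, a))
    \<le> pmf (init_dist M) s + (\<Sum>(s', a)\<in>sa_pairs M. occupation \<pi> n (s', a) * trans_prob M s' a s)"
proof -
  have "(\<Sum>a\<in>allowed M s. occupation \<pi> n (s, a)) = (\<Sum>t<n. visit_prob \<pi> t s)"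
    unfolding occupation_def by (subst sum.swap) (simp add: sum_pair_prob[OF \<pi> s])
  also have "\<dots> \<le> (\<Sum>t<Suc n. visit_prob \<pi> t s)"
    by (simp add: visit_prob_def)
  also have "\<dots> = pmf (init_dist M) s + (\<Sum>t<n. visit_prob \<pi> (Suc t) s)"
    by (simp only: sum.lessThan_Suc_shift visit_prob_0[OF \<pi> s])
  also have "(\<Sum>t<n. visit_prob \<pi> (Suc t) s)
      = (\<Sum>(s', a)\<in>sa_pairs M. occupation \<pi> n (s', a) * trans_prob M s' a s)"
    unfolding occupation_def visit_prob_Suc[OF \<pi> s]
    by (subst sum.swap) (simp add: sum_distrib_right split_beta)
  finally show ?thesis .
qed

text \<open>The mass balance telescopes over time. The probability of being in \<open>Y\<close>
  thereby becomes an affine function of the occupation vector.\<close>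

lemma occupation_entry:
  assumes \<pi>: "is_policy M \<pi>" and Y: "closed_states M Y"
  shows "(\<Sum>s\<in>Y. pmf (init_dist M) s) + (\<Sum>z\<in>sa_pairs M. occupation \<pi> n z * entry_prob M Y z)
    = (\<Sum>s\<in>Y. visit_prob \<pi> n s)"
proof (induction n)
  case 0
  have "visit_prob \<pi> 0 s = pmf (init_dist M) s" if "s \<in> Y" for s
    using visit_prob_0[OF \<pi>] Y that by (auto simp: closed_states_def)
  then show ?case by (simp add: occupation_def)
next
  case (Suc n)
  then show ?case
    by (simp add: occupation_def visit_prob_closed_Suc[OF \<pi> Y] distrib_right sum.distrib)
qed

section \<open>From flow vectors to stationary policies\<close>

lemma disintegrate_weights:
  assumes "\<And>z. z \<in> sa_pairs M \<Longrightarrow> 0 \<le> x z"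
  shows "\<exists>d. \<forall>s\<in>states M. set_pmf (d s) \<subseteq> allowed M s \<and>
    (\<forall>a\<in>allowed M s. x (s, a) = (\<Sum>a\<in>allowed M s. x (s, a)) * pmf (d s) a)"
proof -
  have "\<exists>p. set_pmf p \<subseteq> allowed M s \<and>
      (\<forall>a\<in>allowed M s. x (s, a) = (\<Sum>a\<in>allowed M s. x (s, a)) * pmf p a)" if s: "s \<in> states M" for s
  proof -
    have nn: "0 \<le> x (s, a)" if "a \<in> allowed M s" for a
      using assms that s by (simp add: sa_pairs_def)
    show ?thesis
    proof (cases "(\<Sum>a\<in>allowed M s. x (s, a)) = 0")
      \<comment> \<open>At weight zero both sides of the product form vanish, so any allowed action
        serves.\<close>
      case True
      then have "x (s, a) = 0" if "a \<in> allowed M s" for a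
        using that nn finite_allowed[OF s] by (simp add: sum_nonneg_eq_0_iff)
      moreover obtain a where "a \<in> allowed M s" using allowed_nonempty[OF s] by blast
      ultimately show ?thesis using True by (intro exI[of _ "return_pmf a"]) auto
    next
      case False
      have "\<exists>p. set_pmf p \<subseteq> allowed M s \<and>
          (\<forall>a\<in>allowed M s. pmf p a = x (s, a) / (\<Sum>a\<in>allowed M s. x (s, a)))"
        using False nn finite_allowed[OF s]
        by (intro pmf_of_finite_weights) (auto simp: sum_divide_distrib[symmetric] sum_nonneg)
      then show ?thesis using False by auto
    qed
  qed
  then show ?thesis by metis
qed

text \<open>\<open>x\<close> need not come from a policy and may carry circulations that the initial
  distribution never feeds. They are harmless: a closed set keeps whatever enters it, so bounded
  mass cannot feed it forever.\<close>

lemma stationary_policy_of_flow: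
  assumes nonneg: "\<And>z. z \<in> sa_pairs M \<Longrightarrow> 0 \<le> x z"
    and flow: "\<And>s. s \<in> states M \<Longrightarrow> (\<Sum>a\<in>allowed M s. x (s, a))
      \<le> pmf (init_dist M) s + (\<Sum>(s', a)\<in>sa_pairs M. x (s', a) * trans_prob M s' a s)"
  obtains \<pi> where "is_policy M \<pi>" "stationary M \<pi>"
    "\<And>Y. closed_states M Y \<Longrightarrow>
      (\<Sum>s\<in>Y. pmf (init_dist M) s) + (\<Sum>z\<in>sa_pairs M. x z * entry_prob M Y z) \<le> reach_prob M \<pi> Y"
proof -
  define X where "X s = (\<Sum>a\<in>allowed M s. x (s, a))" for s
  obtain d where d: "\<And>s. s \<in> states M \<Longrightarrow> set_pmf (d s) \<subseteq> allowed M s"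
    and xd: "\<And>s a. s \<in> states M \<Longrightarrow> a \<in> allowed M s \<Longrightarrow> x (s, a) = X s * pmf (d s) a"
    unfolding X_def using disintegrate_weights[of x, OF nonneg] by metis
  define \<pi> :: "('s, 'a) policy" where "\<pi> h = d" for h
  have \<pi>: "is_policy M \<pi>" using d by (simp add: is_policy_def \<pi>_def)
  \<comment> \<open>\<open>w u\<close> spreads state weights over actions by \<open>d\<close>,
    \<open>G\<close> multiplies a row vector by the transition matrix of the induced chain, and
    \<open>m n\<close> is \<open>X\<close> after \<open>n\<close> steps.\<close>
  define w where "w u = (\<lambda>(s, a). u s * pmf (d s) a)" for u :: "'s \<Rightarrow> real"
  define G where "G u s' = (\<Sum>(s, a)\<in>sa_pairs M. w u (s, a) * trans_prob M s a s')" for u s'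
  define m where "m n = (G ^^ n) X" for n
  have m_0: "m 0 = X" and m_Suc: "m (Suc n) = G (m n)" for n by (simp_all add: m_def)
  have xw: "x z = w X z" if "z \<in> sa_pairs M" for z
    using xd that by (auto simp: w_def sa_pairs_def)
  have w_mono: "w u z \<le> w v z" if "\<And>s. s \<in> states M \<Longrightarrow> u s \<le> v s" "z \<in> sa_pairs M" for u v z
    using that by (auto simp: w_def sa_pairs_def mult_right_mono)
  have w_add: "w (\<lambda>s. u s + v s) z = w u z + w v z" for u v z
    by (simp add: w_def split_beta distrib_right)
  have w_sum: "w (\<lambda>s. \<Sum>t<n. u t s) z = (\<Sum>t<n. w (u t) z)" for u z and n :: nat
    by (simp add: w_def split_beta sum_distrib_right)
  have sum_w: "(\<Sum>a\<in>allowed M s. w u (s, a)) = u s" if "s \<in> states M" for u s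
    using d[OF that] finite_allowed[OF that]
    by (simp add: w_def sum_distrib_left[symmetric] sum_pmf_eq_1)
  have G_mono: "G u s \<le> G v s" if "\<And>s. s \<in> states M \<Longrightarrow> u s \<le> v s" "s \<in> states M" for u v s
    unfolding G_def using w_mono[OF that(1)] that(2) trans_prob_nonneg
    by (intro sum_mono) (auto simp: sa_pairs_def intro!: mult_right_mono)
  have G_add: "G (\<lambda>s. u s + v s) s' = G u s' + G v s'" for u v s'
    by (simp add: G_def w_add split_beta distrib_right sum.distrib)
  have G_sum: "G (\<lambda>s. \<Sum>t<n. u t s) s' = (\<Sum>t<n. G (u t) s')" for u s' and n :: nat
    unfolding G_def w_sum by (subst sum.swap) (simp add: sum_distrib_right split_beta)
  have G_closed: "(\<Sum>s\<in>Y. G u s) = (\<Sum>s\<in>Y. u s) + (\<Sum>z\<in>sa_pairs M. w u z * entry_prob M Y z)"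
    if "closed_states M Y" for u Y
  proof -
    have "s \<in> states M" if "s \<in> Y" for s using \<open>closed_states M Y\<close> that by (auto simp: closed_states_def)
    then show ?thesis
      unfolding G_def sum_over_closed_step[OF that, of "w u"] by (simp add: sum_w)
  qed
  have visit_G: "visit_prob \<pi> (Suc t) s = G (visit_prob \<pi> t) s" if "s \<in> states M" for t s
    unfolding visit_prob_Suc[OF \<pi> that] G_def
    by (intro sum.cong refl)
      (auto simp: w_def sa_pairs_def pair_prob_stationary[OF \<pi>, of d] \<pi>_def)
  have X_le: "X s \<le> pmf (init_dist M) s + G X s" if "s \<in> states M" for s
    using flow[OF that] xw by (simp add: X_def G_def split_beta)
  \<comment> \<open>Iterates \<open>X_le\<close>: \<open>G\<close> is monotone and additive, and it
    maps the visit probabilities at \<open>t\<close> to those at \<open>Suc t\<close>. The remainder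
    \<open>m n\<close> is the part of \<open>X\<close> not yet explained by the initial
    distribution.\<close>
  have X_bound: "X s \<le> (\<Sum>t<n. visit_prob \<pi> t s) + m n s" if "s \<in> states M" for n s
    using that
  proof (induction n arbitrary: s)
    case 0
    then show ?case by (simp add: m_0)
  next
    case (Suc n)
    have "X s \<le> visit_prob \<pi> 0 s + G X s"
      using X_le[OF Suc.prems] visit_prob_0[OF \<pi> Suc.prems] by simp
    also have "G X s \<le> G (\<lambda>s. (\<Sum>t<n. visit_prob \<pi> t s) + m n s) s"
      using Suc by (intro G_mono) auto
    also have "\<dots> = (\<Sum>t<n. visit_prob \<pi> (Suc t) s) + m (Suc n) s"
      using visit_G[OF Suc.prems] by (simp add: G_add G_sum m_Suc)
    also have "visit_prob \<pi> 0 s + \<dots> = (\<Sum>t<Suc n. visit_prob \<pi> t s) + m (Suc n) s"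
      by (simp add: sum.lessThan_Suc_shift del: sum.lessThan_Suc)
    finally show ?case by simp
  qed
  have X_nonneg: "0 \<le> X s" if "s \<in> states M" for s
    using nonneg that by (auto simp: X_def sa_pairs_def intro!: sum_nonneg)
  have w_nonneg: "0 \<le> w u z" if "\<And>s. s \<in> states M \<Longrightarrow> 0 \<le> u s" "z \<in> sa_pairs M" for u z
    using that by (auto simp: w_def sa_pairs_def)
  have m_nonneg: "0 \<le> m n s" if "s \<in> states M" for n s
    using that
  proof (induction n arbitrary: s)
    case 0
    then show ?case by (simp add: m_0 X_nonneg)
  next
    case (Suc n)
    then show ?case
      unfolding m_Suc G_def using w_nonneg[of "m n"] trans_prob_nonneg
      by (auto simp: sa_pairs_def intro!: sum_nonneg mult_nonneg_nonneg)
  qed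
  \<comment> \<open>Nothing can enter the set of all states, so \<open>G\<close> preserves total
    mass.\<close>
  have m_total: "(\<Sum>s\<in>states M. m n s) = (\<Sum>s\<in>states M. X s)" for n
  proof (induction n)
    case (Suc n)
    have "(\<Sum>z\<in>sa_pairs M. w (m n) z * entry_prob M (states M) z) = 0"
      by (intro sum.neutral) (auto simp: entry_prob_def sa_pairs_def)
    then show ?case using G_closed[OF closed_states_states, of "m n"] Suc by (simp add: m_Suc)
  qed (simp add: m_0)
  show thesis
  proof (rule that[of \<pi>])
    fix Y assume Y: "closed_states M Y"
    have Ys: "Y \<subseteq> states M" using Y by (simp add: closed_states_def)
    let ?E = "\<lambda>u. \<Sum>z\<in>sa_pairs M. w u z * entry_prob M Y z"
    let ?m = "\<lambda>n. \<Sum>s\<in>Y. m n s" and ?v = "\<lambda>n. \<Sum>s\<in>Y. visit_prob \<pi> n s"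
    text \<open>The residual mass \<open>m n\<close> inside \<open>Y\<close> is monotone and bounded, so the amount of it that
      enters \<open>Y\<close> in step \<open>n\<close> vanishes in the limit.\<close>
    have "incseq ?m"
      using w_nonneg[OF m_nonneg] entry_prob_nonneg[OF Ys]
      by (intro incseq_SucI) (auto simp: m_Suc G_closed[OF Y] intro!: sum_nonneg mult_nonneg_nonneg)
    moreover have "?m n \<le> (\<Sum>s\<in>states M. X s)" for n
      unfolding m_total[symmetric, of n] using m_nonneg finite_states Ys by (intro sum_mono2) auto
    ultimately obtain L where L: "?m \<longlonglongrightarrow> L" using incseq_convergent by blast
    \<comment> \<open>Weighting \<open>X_bound\<close> by the entry probabilities, the visit terms
      telescope to \<open>?v n - ?v 0\<close>, and \<open>?v 0\<close> cancels the initial mass on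
      the left.\<close>
    have bound: "(\<Sum>s\<in>Y. pmf (init_dist M) s) + (\<Sum>z\<in>sa_pairs M. x z * entry_prob M Y z)
        \<le> ?v n + (?m (Suc n) - ?m n)" for n
    proof -
      have "(\<Sum>z\<in>sa_pairs M. x z * entry_prob M Y z) = ?E X" using xw by simp
      also have "\<dots> \<le> ?E (\<lambda>s. (\<Sum>t<n. visit_prob \<pi> t s) + m n s)"
        using w_mono X_bound entry_prob_nonneg[OF Ys]
        by (intro sum_mono mult_right_mono) auto
      also have "\<dots> = (\<Sum>t<n. ?E (visit_prob \<pi> t)) + ?E (m n)"
        unfolding w_add w_sum distrib_right sum.distrib sum_distrib_right
        by (subst sum.swap) simp
      also have "?E (m n) = ?m (Suc n) - ?m n" by (simp add: m_Suc G_closed[OF Y])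
      also have "(\<Sum>t<n. ?E (visit_prob \<pi> t)) = (\<Sum>t<n. ?v (Suc t) - ?v t)"
      proof (intro sum.cong refl)
        fix t
        have "?v (Suc t) = (\<Sum>s\<in>Y. G (visit_prob \<pi> t) s)"
          using visit_G Ys by (intro sum.cong) auto
        then show "?E (visit_prob \<pi> t) = ?v (Suc t) - ?v t" by (simp add: G_closed[OF Y])
      qed
      also have "\<dots> = ?v n - ?v 0" by (rule sum_lessThan_telescope)
      also have "?v 0 = (\<Sum>s\<in>Y. pmf (init_dist M) s)"
        using visit_prob_0[OF \<pi>] Ys by (intro sum.cong) auto
      finally show ?thesis by simp
    qed
    have "(\<lambda>n. ?v n + (?m (Suc n) - ?m n)) \<longlonglongrightarrow> reach_prob M \<pi> Y + (L - L)"
      using visit_prob_tendsto_reach_prob[OF \<pi> Y] L LIMSEQ_Suc[OF L] by (intro tendsto_intros)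
    then show "(\<Sum>s\<in>Y. pmf (init_dist M) s) + (\<Sum>z\<in>sa_pairs M. x z * entry_prob M Y z)
        \<le> reach_prob M \<pi> Y"
      using bound by (intro LIMSEQ_le_const[where X = "\<lambda>n. ?v n + (?m (Suc n) - ?m n)"]) auto
  qed (use \<pi> in \<open>auto simp: stationary_def \<pi>_def\<close>)
qed

text \<open>The approximating policies may be unrelated and their occupation vectors unbounded. Only
  the right-hand sides of the linear constraints need to converge, because closedness of cones then
  supplies an exact flow.\<close>

theorem stationary_policy_of_approximations:
  fixes Y :: "'k \<Rightarrow> 's set" and r :: "'k \<Rightarrow> real"
  assumes K: "finite K" and Y: "\<And>k. k \<in> K \<Longrightarrow> closed_states M (Y k)"
    and approx: "\<And>e. 0 < e \<Longrightarrow> \<exists>\<pi>. is_policy M \<pi> \<and> (\<forall>k\<in>K. r k - e \<le> reach_prob M \<pi> (Y k))"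
  shows "\<exists>\<pi>. is_policy M \<pi> \<and> stationary M \<pi> \<and> (\<forall>k\<in>K. r k \<le> reach_prob M \<pi> (Y k))"
proof -
  let ?\<beta> = "\<lambda>k. \<Sum>s\<in>Y k. pmf (init_dist M) s"
  \<comment> \<open>One \<open>1 / Suc n\<close> of the error pays for the choice of policy, the
    other for stopping at a finite time, common to all \<open>k\<close> since \<open>K\<close> is
    finite.\<close>
  have "\<exists>\<pi> t. is_policy M \<pi> \<and> (\<forall>k\<in>K. r k - 2 / Suc n \<le> (\<Sum>s\<in>Y k. visit_prob \<pi> t s))" for n
  proof -
    obtain \<pi> where \<pi>: "is_policy M \<pi>" and le: "\<forall>k\<in>K. r k - 1 / Suc n \<le> reach_prob M \<pi> (Y k)"
      using approx[of "1 / Suc n"] by auto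
    have "\<forall>\<^sub>F t in sequentially. r k - 2 / Suc n < (\<Sum>s\<in>Y k. visit_prob \<pi> t s)" if k: "k \<in> K" for k
    proof (rule order_tendstoD(1)[OF visit_prob_tendsto_reach_prob[OF \<pi> Y[OF k]]])
      have "1 / real (Suc n) < 2 / real (Suc n)" by (intro divide_strict_right_mono) auto
      then show "r k - 2 / Suc n < reach_prob M \<pi> (Y k)" using bspec[OF le k] by linarith
    qed
    then have "\<forall>\<^sub>F t in sequentially. \<forall>k\<in>K. r k - 2 / Suc n < (\<Sum>s\<in>Y k. visit_prob \<pi> t s)"
      using K by (simp add: eventually_ball_finite)
    then obtain t where "\<forall>k\<in>K. r k - 2 / Suc n < (\<Sum>s\<in>Y k. visit_prob \<pi> t s)"
      by (auto simp: eventually_sequentially)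
    with \<pi> show ?thesis by (intro exI[of _ \<pi>] exI[of _ t]) (auto intro: less_imp_le)
  qed
  then obtain p t where p: "\<And>n. is_policy M (p n)"
    and pt: "\<And>n k. k \<in> K \<Longrightarrow> r k - 2 / Suc n \<le> (\<Sum>s\<in>Y k. visit_prob (p n) (t n) s)"
    by metis
  text \<open>Flow inequalities and lower bounds on the entered mass, all written as \<open>\<le>\<close>
    constraints on a nonnegative combination of the vectors \<open>v z\<close>.\<close>
  define v where "v z = case_sum
      (\<lambda>s. of_bool (fst z = s) - trans_prob M (fst z) (snd z) s) (\<lambda>k. - entry_prob M (Y k) z)" for z
  \<comment> \<open>The error appears only in the right-hand side; the generators \<open>v z\<close>
    stay fixed in \<open>n\<close>, as the cone lemma requires.\<close>
  define b where "b n = case_sum (pmf (init_dist M)) (\<lambda>k. ?\<beta> k - (r k - 2 / Suc n))" for n :: nat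
  define b' where "b' = case_sum (pmf (init_dist M)) (\<lambda>k. ?\<beta> k - r k)"
  have v_Inl: "(\<Sum>z\<in>sa_pairs M. x z * v z (Inl s)) =
      (\<Sum>a\<in>allowed M s. x (s, a)) - (\<Sum>(s', a)\<in>sa_pairs M. x (s', a) * trans_prob M s' a s)"
    if "s \<in> states M" for x s
  proof -
    have "(\<Sum>z\<in>sa_pairs M. x z * of_bool (fst z = s))
        = (\<Sum>s'\<in>states M. if s' = s then \<Sum>a\<in>allowed M s. x (s, a) else 0)"
      unfolding sum_sa_pairs by (intro sum.cong) auto
    then show ?thesis
      using that finite_states by (simp add: v_def right_diff_distrib sum_subtractf split_beta)
  qed
  have v_Inr: "(\<Sum>z\<in>sa_pairs M. x z * v z (Inr k)) = - (\<Sum>z\<in>sa_pairs M. x z * entry_prob M (Y k) z)" for x k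
    by (simp add: v_def sum_negf)
  obtain x where x: "\<And>z. z \<in> sa_pairs M \<Longrightarrow> 0 \<le> x z"
    and xb: "\<And>i. i \<in> states M <+> K \<Longrightarrow> (\<Sum>z\<in>sa_pairs M. x z * v z i) \<le> b' i"
  proof (rule closed_finite_cone_le[of "sa_pairs M" "states M <+> K" "\<lambda>n. occupation (p n) (t n)" v b b'])
    show "finite (sa_pairs M)" "finite (states M <+> K)"
      using finite_sa_pairs finite_states K by auto
    show "0 \<le> occupation (p n) (t n) z" for n z by (rule occupation_nonneg)
    show "(\<Sum>z\<in>sa_pairs M. occupation (p n) (t n) z * v z i) \<le> b n i" if i: "i \<in> states M <+> K" for n i
    proof (cases i)
      case (Inl s)
      then have "s \<in> states M" using i by auto
      then show ?thesis using occupation_flow[OF p, of s n "t n"] Inl by (simp add: v_Inl b_def)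
    next
      case (Inr k)
      then have "k \<in> K" using i by auto
      then show ?thesis
        using occupation_entry[OF p Y, of k n "t n"] pt[of k n] Inr by (simp add: v_Inr b_def)
    qed
    have *: "(\<lambda>n. 2 / real (Suc n)) \<longlonglongrightarrow> 0"
      using tendsto_mult_right_zero[OF LIMSEQ_inverse_real_of_nat, of 2] by (simp add: divide_inverse)
    have "(\<lambda>n. ?\<beta> k - (r k - 2 / Suc n)) \<longlonglongrightarrow> ?\<beta> k - (r k - 0)" for k
      by (intro tendsto_intros *)
    then show "(\<lambda>n. b n i) \<longlonglongrightarrow> b' i" for i
      by (cases i) (auto simp: b_def b'_def)
  qed blast
  have "(\<Sum>a\<in>allowed M s. x (s, a))
      \<le> pmf (init_dist M) s + (\<Sum>(s', a)\<in>sa_pairs M. x (s', a) * trans_prob M s' a s)"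
    if "s \<in> states M" for s
    using xb[of "Inl s"] that by (simp add: v_Inl b'_def InlI)
  from stationary_policy_of_flow[of x, OF x this] obtain \<pi> where
    \<pi>: "is_policy M \<pi>" "stationary M \<pi>" and reach: "\<And>Y. closed_states M Y \<Longrightarrow>
      (\<Sum>s\<in>Y. pmf (init_dist M) s) + (\<Sum>z\<in>sa_pairs M. x z * entry_prob M Y z) \<le> reach_prob M \<pi> Y"
    by metis
  have "r k \<le> reach_prob M \<pi> (Y k)" if "k \<in> K" for k
    using xb[OF InrI[OF that]] reach[OF Y[OF that]] by (simp add: v_Inr b'_def)
  with \<pi> show ?thesis by blast
qed

text \<open>Feasible policies with values near the supremum \<open>V\<close> meet the bound \<tau>
  without error. They therefore approximate \<open>V\<close> and \<tau> simultaneously, and the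
  preceding theorem attains both.\<close>

theorem stationary_constrained_optimum:
  assumes Y: "closed_states M Y" and Z: "closed_states M Z"
    and feasible: "is_policy M \<pi>\<^sub>0" "reach_prob M \<pi>\<^sub>0 Z \<ge> \<tau>"
  shows "\<exists>\<pi>. is_policy M \<pi> \<and> stationary M \<pi> \<and> reach_prob M \<pi> Z \<ge> \<tau> \<and>
    (\<forall>\<pi>'. is_policy M \<pi>' \<and> reach_prob M \<pi>' Z \<ge> \<tau> \<longrightarrow> reach_prob M \<pi>' Y \<le> reach_prob M \<pi> Y)"
proof -
  define F where "F = {\<pi>. is_policy M \<pi> \<and> reach_prob M \<pi> Z \<ge> \<tau>}"
  define V where "V = (SUP \<pi>\<in>F. reach_prob M \<pi> Y)"
  have F: "F \<noteq> {}" using feasible by (auto simp: F_def)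
  have "reach_prob M \<pi> Y \<le> 1" if "\<pi> \<in> F" for \<pi>
    using that prob_space.prob_le_1[OF prob_space_traj_measure[of \<pi>]]
    by (simp add: F_def reach_prob_def)
  then have bdd: "bdd_above ((\<lambda>\<pi>. reach_prob M \<pi> Y) ` F)" by (intro bdd_aboveI2)
  \<comment> \<open>Objective and constraint are treated alike, as two lower bounds on reachability
    indexed by \<open>bool\<close>.\<close>
  let ?Y = "\<lambda>b. if b then Y else Z" and ?r = "\<lambda>b. if b then V else \<tau>"
  have "\<exists>\<pi>. is_policy M \<pi> \<and> stationary M \<pi> \<and> (\<forall>b\<in>UNIV. ?r b \<le> reach_prob M \<pi> (?Y b))"
  proof (rule stationary_policy_of_approximations)
    fix e :: real assume "0 < e"
    then have "V - e < V" by simp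
    then obtain \<pi> where "\<pi> \<in> F" "V - e < reach_prob M \<pi> Y"
      unfolding V_def using less_cSUP_iff[OF F bdd] by blast
    then show "\<exists>\<pi>. is_policy M \<pi> \<and> (\<forall>b\<in>UNIV. ?r b - e \<le> reach_prob M \<pi> (?Y b))"
      using \<open>0 < e\<close> by (intro exI[of _ \<pi>]) (auto simp: F_def)
  qed (use Y Z in auto)
  then obtain \<pi> where "is_policy M \<pi>" "stationary M \<pi>"
    and opt: "\<And>b. ?r b \<le> reach_prob M \<pi> (?Y b)" by auto
  moreover have "reach_prob M \<pi> Z \<ge> \<tau>" using opt[of False] by simp
  moreover have "reach_prob M \<pi>' Y \<le> reach_prob M \<pi> Y" if "is_policy M \<pi>' \<and> reach_prob M \<pi>' Z \<ge> \<tau>" for \<pi>'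
  proof -
    have "reach_prob M \<pi>' Y \<le> V"
      unfolding V_def using that bdd by (intro cSUP_upper) (auto simp: F_def)
    then show ?thesis using opt[of True] by simp
  qed
  ultimately show ?thesis by blast
qed

end

section \<open>Application to the double product\<close>

lemma closed_states_target_phi:
  assumes "lmdp M" "absorbing_dfa D" "alphabet D = Pow (props M)"
  shows "closed_states (double_product M D E) (target_phi (double_product M D E))"
  \<comment> \<open>Every label is a letter, so a final automaton state stays fixed; a successor
    outside the target has a different automaton state and gets probability 0.\<close>
  using dfa.final_subset[OF absorbing_dfa.axioms(1)[OF assms(2)]]
    absorbing_dfa.final_absorbing[OF assms(2)] lmdp.label_subset[OF assms(1)] assms(3)
  by (auto simp: closed_states_def double_product_def split: if_splits)

lemma closed_states_target_psi:
  assumes "lmdp M" "absorbing_dfa E" "alphabet E = Pow (props M)"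
  shows "closed_states (double_product M D E) (target_psi (double_product M D E))"
  using dfa.final_subset[OF absorbing_dfa.axioms(1)[OF assms(2)]]
    absorbing_dfa.final_absorbing[OF assms(2)] lmdp.label_subset[OF assms(1)] assms(3)
  by (auto simp: closed_states_def double_product_def split: if_splits)

theorem theorem1:
  fixes M :: "('s, 'a, 'l) lmdp"
    and A\<phi> :: "('q, 'l set) dfa"
    and A\<psi> :: "('r, 'l set) dfa"
    and \<tau> :: real
  defines "P \<equiv> double_product M A\<phi> A\<psi>"
  assumes "lmdp M"
    and "absorbing_dfa A\<phi>" and "alphabet A\<phi> = Pow (props M)"
    and "absorbing_dfa A\<psi>" and "alphabet A\<psi> = Pow (props M)"
    and "0 \<le> \<tau>" and "\<tau> \<le> 1"
    and feasible: "\<exists>\<pi>. is_policy P \<pi> \<and> reach_prob P \<pi> (target_psi P) \<ge> \<tau>"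
  shows "\<exists>\<pi>. is_policy P \<pi> \<and> stationary P \<pi> \<and> reach_prob P \<pi> (target_psi P) \<ge> \<tau> \<and>
    (\<forall>\<pi>'. is_policy P \<pi>' \<and> reach_prob P \<pi>' (target_psi P) \<ge> \<tau> \<longrightarrow>
      reach_prob P \<pi>' (target_phi P) \<le> reach_prob P \<pi> (target_phi P))"
proof -
  have "mdp P"
    unfolding P_def using assms(2-6)
    by (intro mdp_double_product) (auto dest: absorbing_dfa.axioms(1))
  moreover have "closed_states P (target_phi P)" "closed_states P (target_psi P)"
    unfolding P_def using assms(2-6)
    by (auto intro: closed_states_target_phi closed_states_target_psi)
  ultimately show ?thesis
    using feasible mdp.stationary_constrained_optimum by blast
qed

end
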